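(* Let $G_0$ and $G_1$ be nonempty simple matroids on disjoint ground sets, choose points $p_0$ of $G_0$ and $p_1$ of $G_1$, and let $P(G_0,G_1)$ be the parallel connection of $G_0$ and $G_1$ along $p_0$ and $p_1$. Let $G=G_0\oplus G_1$ and $G'=\{0\}\oplus P(G_0,G_1)$, where $\{0\}$ is the rank-one matroid consisting of a single isthmus $0$. Then $\mathcal{A}(G)\cong\mathcal{A}(G')$ as graded algebras.
   Context: For a simple matroid $H$ on a finite ground set $E$, let $\mathcal{E}=\Lambda(e_i : i\in E)$ be the graded exterior algebra over $\mathbb{C}$ with generators $e_i$ of degree one. For an ordered tuple $S=(i_1,\ldots,i_p)$ write $e_S=e_{i_1}\wedge\cdots\wedge e_{i_p}$ and define $\partial:\mathcal{E}^p\to\mathcal{E}^{p-1}$ by $\partial(e_{i_1}\wedge\cdots\wedge e_{i_p})=\sum_{k=1}^p(-1)^{k-1}e_{i_1}\wedge\cdots\wedge\widehat{e_{i_k}}\wedge\cdots\wedge e_{i_p}$. Let $\mathcal{I}$ be the ideal generated by $\{\partial e_S : S\text{ dependent in }H\}$; the Orlik-Solomon algebra of $H$ is the graded algebra $\mathcal{A}(H)=\mathcal{E}/\mathcal{I}$. The parallel connection $P(G_0,G_1)$ along $p_0,p_1$ is the matroid whose ground set is the union of the ground sets of $G_0$ and $G_1$ with $p_0$ and $p_1$ identified to a single point $p$, and whose circuits are the circuits of $G_0$, the circuits of $G_1$, and the sets $(C_0\setminus\{p\})\cup(C_1\setminus\{p\})$ with $C_i$ a circuit of $G_i$ containing $p$.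 The symbol $\oplus$ denotes direct sum of matroids. *)

theory Defs
  imports
    Complex_Main
    "HOL-Library.Poly_Mapping"
    "HOL-Algebra.QuotRing"
    "HOL-Algebra.Module"
begin

section \<open>Matroids\<close>

text \<open>Matroids are presented by their circuits (Whitney's circuit axioms).\<close>

record 'a circuit_system =
  ground :: "'a set"
  circuits :: "'a set set"

definition matroid :: "'a circuit_system \<Rightarrow> bool" where
  "matroid M \<longleftrightarrow>
     finite (ground M) \<and>
     circuits M \<subseteq> Pow (ground M) \<and>
     {} \<notin> circuits M \<and>
     (\<forall>C\<in>circuits M. \<forall>D\<in>circuits M. C \<subseteq> D \<longrightarrow> C = D) \<and>
     (\<forall>C\<in>circuits M. \<forall>D\<in>circuits M. \<forall>x\<in>C \<inter> D. C \<noteq> D \<longrightarrow>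
        (\<exists>K\<in>circuits M. K \<subseteq> (C \<union> D) - {x}))"

definition simple_matroid :: "'a circuit_system \<Rightarrow> bool" where
  "simple_matroid M \<longleftrightarrow> matroid M \<and>
     (\<forall>x. {x} \<notin> circuits M) \<and> (\<forall>x y. {x, y} \<notin> circuits M)"

definition dependent :: "'a circuit_system \<Rightarrow> 'a set \<Rightarrow> bool" where
  "dependent M X \<longleftrightarrow> X \<subseteq> ground M \<and> (\<exists>C\<in>circuits M. C \<subseteq> X)"

text \<open>Meaningful only for disjoint ground sets.\<close>

definition direct_sum :: "'a circuit_system \<Rightarrow> 'a circuit_system \<Rightarrow> 'a circuit_system" where
  "direct_sum M N = \<lparr>ground = ground M \<union> ground N, circuits = circuits M \<union> circuits N\<rparr>"

text \<open>The single element is in no circuit, hence an isthmus, and the rank is one.\<close>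

definition isthmus :: "'a \<Rightarrow> 'a circuit_system" where
  "isthmus z = \<lparr>ground = {z}, circuits = {}\<rparr>"

definition relabel :: "('a \<Rightarrow> 'b) \<Rightarrow> 'a circuit_system \<Rightarrow> 'b circuit_system" where
  "relabel f M = \<lparr>ground = f ` ground M, circuits = image f ` circuits M\<rparr>"

definition glue_at :: "'a \<Rightarrow> 'a circuit_system \<Rightarrow> 'a circuit_system \<Rightarrow> 'a circuit_system" where
  "glue_at p M N =
     \<lparr>ground = ground M \<union> ground N,
      circuits = circuits M \<union> circuits N \<union>
        {(C - {p}) \<union> (D - {p}) | C D. C \<in> circuits M \<and> D \<in> circuits N \<and> p \<in> C \<and> p \<in> D}\<rparr>"

text \<open>
  The points \<open>p0\<close> and \<open>p1\<close> are identified by renaming both of them to \<open>p\<close>. The label \<open>p\<close> may be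
  \<open>p0\<close>, \<open>p1\<close> or a new element, but no other element of either ground set.
\<close>

definition parallel_connection ::
  "'a circuit_system \<Rightarrow> 'a \<Rightarrow> 'a circuit_system \<Rightarrow> 'a \<Rightarrow> 'a \<Rightarrow> 'a circuit_system" where
  "parallel_connection M p0 N p1 p =
     glue_at p (relabel (id(p0 := p)) M) (relabel (id(p1 := p)) N)"

lemma simple_imp_matroid: "simple_matroid M \<Longrightarrow> matroid M"
  by (simp add: simple_matroid_def)

lemma simple_matroid_isthmus: "simple_matroid (isthmus z)"
  by (simp add: simple_matroid_def matroid_def isthmus_def)

lemma simple_matroid_direct_sum:
  assumes "simple_matroid M" "simple_matroid N" "ground M \<inter> ground N = {}"
  shows "simple_matroid (direct_sum M N)"
proof -
  have M: "matroid M" and N: "matroid N"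
    using assms(1,2) by (simp_all add: simple_matroid_def)
  have disj: "C \<inter> D = {}" if "C \<in> circuits M" "D \<in> circuits N" for C D
  proof -
    have "C \<subseteq> ground M" "D \<subseteq> ground N" using M N that by (auto simp: matroid_def)
    then show ?thesis using assms(3) by blast
  qed
  have ne: "{} \<notin> circuits M" "{} \<notin> circuits N"
    using M N by (simp_all add: matroid_def)
  have "matroid (direct_sum M N)"
    unfolding matroid_def direct_sum_def circuit_system.simps
  proof (intro conjI ballI impI)
    show "finite (ground M \<union> ground N)" "circuits M \<union> circuits N \<subseteq> Pow (ground M \<union> ground N)"
      "{} \<notin> circuits M \<union> circuits N"
      using M N unfolding matroid_def by auto
  next
    fix C D assume CD: "C \<in> circuits M \<union> circuits N" "D \<in> circuits M \<union> circuits N" "C \<subseteq> D"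
    have "C \<noteq> {}" using CD(1) ne by auto
    then have "C \<inter> D \<noteq> {}" "D \<inter> C \<noteq> {}" using CD(3) by auto
    then consider "C \<in> circuits M" "D \<in> circuits M" | "C \<in> circuits N" "D \<in> circuits N"
      using CD(1,2) disj by blast
    then show "C = D"
      using M N CD(3) unfolding matroid_def by cases simp_all
  next
    fix C D x
    assume a: "C \<in> circuits M \<union> circuits N" "D \<in> circuits M \<union> circuits N" "x \<in> C \<inter> D" "C \<noteq> D"
    then consider "C \<in> circuits M" "D \<in> circuits M" | "C \<in> circuits N" "D \<in> circuits N"
      using disj by blast
    then show "\<exists>K\<in>circuits M \<union> circuits N. K \<subseteq> C \<union> D - {x}"
    proof cases
      case 1
      then have "\<exists>K\<in>circuits M. K \<subseteq> C \<union> D - {x}" using M a(3,4) unfolding matroid_def by blast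
      then show ?thesis by blast
    next
      case 2
      then have "\<exists>K\<in>circuits N. K \<subseteq> C \<union> D - {x}" using N a(3,4) unfolding matroid_def by blast
      then show ?thesis by blast
    qed
  qed
  then show ?thesis
    using assms by (simp add: simple_matroid_def direct_sum_def)
qed

lemma simple_matroid_relabel:
  assumes M: "simple_matroid M" and inj: "inj_on f (ground M)"
  shows "simple_matroid (relabel f M)"
proof -
  have sub: "C \<subseteq> ground M" if "C \<in> circuits M" for C
    using M that by (auto simp: simple_matroid_def matroid_def)
  have elim: "\<exists>K\<in>circuits M. K \<subseteq> C \<union> D - {x}"
    if "C \<in> circuits M" "D \<in> circuits M" "x \<in> C" "x \<in> D" "C \<noteq> D" for C D x
    using M that unfolding simple_matroid_def matroid_def by blast
  have "matroid (relabel f M)"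
    unfolding matroid_def relabel_def circuit_system.simps
  proof (intro conjI ballI impI)
    show "finite (f ` ground M)" "image f ` circuits M \<subseteq> Pow (f ` ground M)"
      "{} \<notin> image f ` circuits M"
      using M unfolding simple_matroid_def matroid_def by auto
  next
    fix C D assume "C \<in> image f ` circuits M" "D \<in> image f ` circuits M" "C \<subseteq> D"
    then obtain C' D' where "C' \<in> circuits M" "D' \<in> circuits M" "C = f ` C'" "D = f ` D'" "f ` C' \<subseteq> f ` D'"
      by blast
    moreover from this have "C' \<subseteq> D'"
      using inj sub by (metis inj_on_image_mem_iff image_subset_iff subsetD subsetI)
    ultimately show "C = D"
      using M unfolding simple_matroid_def matroid_def by blast
  next
    fix C D x
    assume a: "C \<in> image f ` circuits M" "D \<in> image f ` circuits M" "x \<in> C \<inter> D" "C \<noteq> D"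
    then obtain C' D' where b: "C' \<in> circuits M" "D' \<in> circuits M" "C = f ` C'" "D = f ` D'"
      by blast
    obtain y y' where y: "y \<in> C'" "y' \<in> D'" "x = f y" "x = f y'"
      using a(3) b(3,4) by blast
    have "y' = y" using inj y sub b(1,2) by (metis inj_onD subsetD)
    then have y: "y \<in> C'" "y \<in> D'" "x = f y" using y by simp_all
    have "C' \<noteq> D'" using a b by auto
    then obtain K where K: "K \<in> circuits M" "K \<subseteq> C' \<union> D' - {y}"
      using elim[OF b(1,2) y(1,2)] by blast
    have "f ` K \<subseteq> C \<union> D - {x}"
    proof -
      have "f k \<noteq> f y" if "k \<in> K" for k
        using that K y(1) inj sub[OF b(1)] sub[OF K(1)] by (metis DiffE inj_onD insertI1 subsetD)
      then show ?thesis using K(2) b y by blast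
    qed
    then show "\<exists>K\<in>image f ` circuits M. K \<subseteq> C \<union> D - {x}"
      using K(1) by blast
  qed
  moreover have "\<exists>x y. C = {x, y}" if "f ` C = {u, v}" "C \<in> circuits M" for C u v
  proof -
    have "inj_on f C" using inj sub[OF that(2)] inj_on_subset by blast
    then have "card C = card {u, v}" using that(1) card_image by metis
    then have "card C = 1 \<or> card C = 2" by (simp add: card_insert_if)
    then show ?thesis by (metis card_1_singletonE card_2_iff insert_absorb2)
  qed
  ultimately show ?thesis
    using M unfolding simple_matroid_def relabel_def by (auto, (metis insert_absorb2)+)
qed

lemma big_circuit:
  assumes "simple_matroid M" "C \<in> circuits M"
  shows "\<exists>u v. u \<in> C \<and> v \<in> C \<and> u \<noteq> v \<and> u \<noteq> p \<and> v \<noteq> p"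
proof (rule ccontr)
  assume neg: "\<not> ?thesis"
  have "C = {} \<or> (\<exists>u v. C = {u, v})"
  proof (cases "\<exists>u\<in>C. u \<noteq> p")
    case True
    then obtain u where "u \<in> C" "u \<noteq> p" by blast
    then have "C = {u, u} \<or> C = {u, p}" using neg by auto
    then show ?thesis by blast
  next
    case False
    then have "C = {} \<or> C = {p, p}" by auto
    then show ?thesis by blast
  qed
  then show False using assms by (auto simp: simple_matroid_def matroid_def)
qed

lemma simple_matroid_glue_at:
  assumes M: "simple_matroid M" and N: "simple_matroid N" and meet: "ground M \<inter> ground N = {p}"
  shows "simple_matroid (glue_at p M N)"
proof -
  define X where "X = {(C - {p}) \<union> (D - {p}) | C D. C \<in> circuits M \<and> D \<in> circuits N \<and> p \<in> C \<and> p \<in> D}"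
  have circ: "circuits (glue_at p M N) = circuits M \<union> circuits N \<union> X"
    and gr: "ground (glue_at p M N) = ground M \<union> ground N"
    by (simp_all add: glue_at_def X_def)
  have subM: "C \<subseteq> ground M" if "C \<in> circuits M" for C
    using M that by (auto simp: simple_matroid_def matroid_def)
  have subN: "C \<subseteq> ground N" if "C \<in> circuits N" for C
    using N that by (auto simp: simple_matroid_def matroid_def)
  have antiM: "C = D" if "C \<in> circuits M" "D \<in> circuits M" "C \<subseteq> D" for C D
    using M that unfolding simple_matroid_def matroid_def by blast
  have antiN: "C = D" if "C \<in> circuits N" "D \<in> circuits N" "C \<subseteq> D" for C D
    using N that unfolding simple_matroid_def matroid_def by blast
  have elimM: "\<exists>K\<in>circuits M. K \<subseteq> C \<union> D - {x}"
    if "C \<in> circuits M" "D \<in> circuits M" "x \<in> C" "x \<in> D" "C \<noteq> D" for C D x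
    using M that unfolding simple_matroid_def matroid_def by blast
  have elimN: "\<exists>K\<in>circuits N. K \<subseteq> C \<union> D - {x}"
    if "C \<in> circuits N" "D \<in> circuits N" "x \<in> C" "x \<in> D" "C \<noteq> D" for C D x
    using N that unfolding simple_matroid_def matroid_def by blast
  have bigM: "\<exists>u v. u \<in> C \<and> v \<in> C \<and> u \<noteq> v \<and> u \<noteq> p \<and> v \<noteq> p" if "C \<in> circuits M" for C
    by (rule big_circuit[OF M that])
  have bigN: "\<exists>u v. u \<in> C \<and> v \<in> C \<and> u \<noteq> v \<and> u \<noteq> p \<and> v \<noteq> p" if "C \<in> circuits N" for C
    by (rule big_circuit[OF N that])
  have common: "x = p" if "x \<in> ground M" "x \<in> ground N" for x
    using meet that by blast
  have XE: "\<exists>C D. Z = (C - {p}) \<union> (D - {p}) \<and> C \<in> circuits M \<and> D \<in> circuits N \<and> p \<in> C \<and> p \<in> D"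
    if "Z \<in> X" for Z
    using that by (auto simp: X_def)
  have XI: "(C - {p}) \<union> (D - {p}) \<in> X" if "C \<in> circuits M" "D \<in> circuits N" "p \<in> C" "p \<in> D" for C D
    using that by (auto simp: X_def)
  have splitM: "C - {p} \<subseteq> C'" if "C - {p} \<subseteq> (C' - {p}) \<union> (D' - {p})" "C \<subseteq> ground M" "D' \<subseteq> ground N" for C C' D'
    using that common by blast
  have splitN: "D - {p} \<subseteq> D'" if "D - {p} \<subseteq> (C' - {p}) \<union> (D' - {p})" "D \<subseteq> ground N" "C' \<subseteq> ground M" for D C' D'
    using that common by blast
  have anti: "C = D" if C: "C \<in> circuits M \<union> circuits N \<union> X" and D: "D \<in> circuits M \<union> circuits N \<union> X"
    and le: "C \<subseteq> D" for C D
  proof -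
    have cross: False if "A \<in> circuits M" "B \<in> circuits N" "A \<subseteq> B \<or> B \<subseteq> A" for A B
      using that bigM[OF that(1)] bigN[OF that(2)] subM[OF that(1)] subN[OF that(2)] common by blast
    have MX: False if "A \<in> circuits M" and BX: "B \<in> X" and "A \<subseteq> B \<or> B \<subseteq> A" for A B
    proof -
      obtain B0 B1 where B: "B = (B0 - {p}) \<union> (B1 - {p})" "B0 \<in> circuits M" "B1 \<in> circuits N" "p \<in> B0" "p \<in> B1"
        using XE[OF BX] by blast
      show False
      proof (cases "A \<subseteq> B")
        case True
        then have "A \<subseteq> B0" "p \<notin> A" using B subM[OF that(1)] subN[OF B(3)] common by blast+
        then show False using antiM[OF that(1) B(2)] B(4) by blast
      next
        case False
        then have "B1 - {p} \<subseteq> A" using that(3) B by blast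
        then show False using bigN[OF B(3)] subN[OF B(3)] subM[OF that(1)] common by blast
      qed
    qed
    have NX: False if "A \<in> circuits N" and BX: "B \<in> X" and "A \<subseteq> B \<or> B \<subseteq> A" for A B
    proof -
      obtain B0 B1 where B: "B = (B0 - {p}) \<union> (B1 - {p})" "B0 \<in> circuits M" "B1 \<in> circuits N" "p \<in> B0" "p \<in> B1"
        using XE[OF BX] by blast
      show False
      proof (cases "A \<subseteq> B")
        case True
        then have "A \<subseteq> B1" "p \<notin> A" using B subN[OF that(1)] subM[OF B(2)] common by blast+
        then show False using antiN[OF that(1) B(3)] B(5) by blast
      next
        case False
        then have "B0 - {p} \<subseteq> A" using that(3) B by blast
        then show False using bigM[OF B(2)] subM[OF B(2)] subN[OF that(1)] common by blast
      qed
    qed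
    have XX: "A = B" if A: "A \<in> X" and B: "B \<in> X" and AB: "A \<subseteq> B" for A B
    proof -
      obtain A0 A1 where A: "A = (A0 - {p}) \<union> (A1 - {p})" "A0 \<in> circuits M" "A1 \<in> circuits N" "p \<in> A0" "p \<in> A1"
        using XE[OF A] by blast
      obtain B0 B1 where B: "B = (B0 - {p}) \<union> (B1 - {p})" "B0 \<in> circuits M" "B1 \<in> circuits N" "p \<in> B0" "p \<in> B1"
        using XE[OF B] by blast
      have "A0 - {p} \<subseteq> (B0 - {p}) \<union> (B1 - {p})" "A1 - {p} \<subseteq> (B0 - {p}) \<union> (B1 - {p})"
        using AB by (simp_all add: A(1) B(1))
      from splitM[OF this(1) subM[OF A(2)] subN[OF B(3)]] splitN[OF this(2) subN[OF A(3)] subM[OF B(2)]]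
      have "A0 - {p} \<subseteq> B0" "A1 - {p} \<subseteq> B1" .
      then have "A0 \<subseteq> B0" "A1 \<subseteq> B1" using B(4,5) by blast+
      then show ?thesis using antiM[OF A(2) B(2)] antiN[OF A(3) B(3)] A(1) B(1) by simp
    qed
    consider "C \<in> circuits M" "D \<in> circuits M" | "C \<in> circuits M" "D \<in> circuits N" | "C \<in> circuits M" "D \<in> X"
      | "C \<in> circuits N" "D \<in> circuits M" | "C \<in> circuits N" "D \<in> circuits N" | "C \<in> circuits N" "D \<in> X"
      | "C \<in> X" "D \<in> circuits M" | "C \<in> X" "D \<in> circuits N" | "C \<in> X" "D \<in> X"
      using C D by blast
    then show ?thesis
    proof cases
      case 1 then show ?thesis using le by (rule antiM)
    next
      case 2 then show ?thesis using cross[OF 2] le by simp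
    next
      case 3 then show ?thesis using MX[OF 3] le by simp
    next
      case 4 then show ?thesis using cross[OF 4(2,1)] le by simp
    next
      case 5 then show ?thesis using le by (rule antiN)
    next
      case 6 then show ?thesis using NX[OF 6] le by simp
    next
      case 7 then show ?thesis using MX[OF 7(2,1)] le by simp
    next
      case 8 then show ?thesis using NX[OF 8(2,1)] le by simp
    next
      case 9 then show ?thesis using le by (rule XX)
    qed
  qed
  have elim: "\<exists>K\<in>circuits M \<union> circuits N \<union> X. K \<subseteq> C \<union> D - {x}"
    if C: "C \<in> circuits M \<union> circuits N \<union> X" and D: "D \<in> circuits M \<union> circuits N \<union> X"
      and x: "x \<in> C" "x \<in> D" and ne: "C \<noteq> D" for C D x
  proof -
    let ?R = "\<lambda>Y. \<exists>K\<in>circuits M \<union> circuits N \<union> X. K \<subseteq> Y"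
    have cross: "?R (A \<union> B - {x})" if AB: "A \<in> circuits M" "B \<in> circuits N" "x \<in> A" "x \<in> B" for A B
    proof -
      have "x = p" using AB subM subN common by blast
      then show ?thesis using AB XI[OF AB(1,2)] by (intro bexI[of _ "(A - {p}) \<union> (B - {p})"]) auto
    qed
    have auxM: "?R (A \<union> (B0 - {p}) \<union> (B1 - {p}) - {x})"
      if AB: "A \<in> circuits M" "B0 \<in> circuits M" "B1 \<in> circuits N" "p \<in> B0" "p \<in> B1" "x \<in> A" "x \<in> B0"
        "x \<noteq> p" "A \<noteq> B0" for A B0 B1
    proof -
      obtain K where K: "K \<in> circuits M" "K \<subseteq> A \<union> B0 - {x}"
        using elimM[OF AB(1,2) AB(6,7,9)] by blast
      have x1: "x \<notin> B1" using AB subM[OF AB(1)] subN[OF AB(3)] common by blast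
      show ?thesis
      proof (cases "p \<in> K")
        case True
        then show ?thesis using XI[OF K(1) AB(3) True AB(5)] K(2) x1 AB(8)
          by (intro bexI[of _ "(K - {p}) \<union> (B1 - {p})"]) auto
      next
        case False
        then show ?thesis using K by (intro bexI[of _ K]) auto
      qed
    qed
    have auxN: "?R (A \<union> (B0 - {p}) \<union> (B1 - {p}) - {x})"
      if AB: "A \<in> circuits N" "B0 \<in> circuits M" "B1 \<in> circuits N" "p \<in> B0" "p \<in> B1" "x \<in> A" "x \<in> B1"
        "x \<noteq> p" "A \<noteq> B1" for A B0 B1
    proof -
      obtain K where K: "K \<in> circuits N" "K \<subseteq> A \<union> B1 - {x}"
        using elimN[OF AB(1,3) AB(6,7,9)] by blast
      have x1: "x \<notin> B0" using AB subN[OF AB(1)] subM[OF AB(2)] common by blast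
      show ?thesis
      proof (cases "p \<in> K")
        case True
        then show ?thesis using XI[OF AB(2) K(1) AB(4) True] K(2) x1 AB(8)
          by (intro bexI[of _ "(B0 - {p}) \<union> (K - {p})"]) auto
      next
        case False
        then show ?thesis using K by (intro bexI[of _ K]) auto
      qed
    qed
    have MX: "?R (A \<union> B - {x})" if A: "A \<in> circuits M" and B: "B \<in> X" and x: "x \<in> A" "x \<in> B" for A B
    proof -
      obtain B0 B1 where B: "B = (B0 - {p}) \<union> (B1 - {p})" "B0 \<in> circuits M" "B1 \<in> circuits N" "p \<in> B0" "p \<in> B1"
        using XE[OF B] by blast
      have xp: "x \<noteq> p" "x \<in> B0" "x \<notin> B1" using x B(1) subM[OF A] subN[OF B(3)] common by blast+
      show ?thesis
      proof (cases "A = B0")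
        case True
        then show ?thesis using B xp by (intro bexI[of _ B1]) auto
      next
        case False
        then show ?thesis using auxM[OF A B(2-5) x(1) xp(2,1)] by (simp add: B(1) Un_assoc)
      qed
    qed
    have NX: "?R (A \<union> B - {x})" if A: "A \<in> circuits N" and B: "B \<in> X" and x: "x \<in> A" "x \<in> B" for A B
    proof -
      obtain B0 B1 where B: "B = (B0 - {p}) \<union> (B1 - {p})" "B0 \<in> circuits M" "B1 \<in> circuits N" "p \<in> B0" "p \<in> B1"
        using XE[OF B] by blast
      have xp: "x \<noteq> p" "x \<in> B1" "x \<notin> B0" using x B(1) subN[OF A] subM[OF B(2)] common by blast+
      show ?thesis
      proof (cases "A = B1")
        case True
        then show ?thesis using B xp by (intro bexI[of _ B0]) auto
      next
        case False
        then show ?thesis using auxN[OF A B(2-5) x(1) xp(2,1)] by (simp add: B(1) Un_assoc)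
      qed
    qed
    have XX: "?R (A \<union> B - {x})" if A: "A \<in> X" and B: "B \<in> X" and x: "x \<in> A" "x \<in> B" and ne: "A \<noteq> B" for A B
    proof -
      obtain A0 A1 where A: "A = (A0 - {p}) \<union> (A1 - {p})" "A0 \<in> circuits M" "A1 \<in> circuits N" "p \<in> A0" "p \<in> A1"
        using XE[OF A] by blast
      obtain B0 B1 where B: "B = (B0 - {p}) \<union> (B1 - {p})" "B0 \<in> circuits M" "B1 \<in> circuits N" "p \<in> B0" "p \<in> B1"
        using XE[OF B] by blast
      note sub = subM[OF A(2)] subN[OF A(3)] subM[OF B(2)] subN[OF B(3)]
      have xp: "x \<noteq> p" using x A(1) by blast
      consider "x \<in> A0" "x \<in> B0" "x \<notin> A1" "x \<notin> B1" | "x \<in> A1" "x \<in> B1" "x \<notin> A0" "x \<notin> B0"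
        using x xp A(1) B(1) sub common by blast
      then show ?thesis
      proof cases
        case 1
        show ?thesis
        proof (cases "A0 = B0")
          case True
          then have "A1 \<noteq> B1" using ne A(1) B(1) by blast
          then obtain K where K: "K \<in> circuits N" "K \<subseteq> A1 \<union> B1 - {p}"
            using elimN[OF A(3) B(3) A(5) B(5)] by blast
          then show ?thesis using 1 by (intro bexI[of _ K]) (auto simp: A(1) B(1))
        next
          case False
          obtain K where K: "K \<in> circuits M" "K \<subseteq> A0 \<union> B0 - {x}"
            using elimM[OF A(2) B(2) 1(1,2) False] by blast
          show ?thesis
          proof (cases "p \<in> K")
            case True
            then show ?thesis using XI[OF K(1) A(3) True A(5)] K(2) 1
              by (intro bexI[of _ "(K - {p}) \<union> (A1 - {p})"]) (auto simp: A(1) B(1))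
          next
            case False
            then show ?thesis using K by (intro bexI[of _ K]) (auto simp: A(1) B(1))
          qed
        qed
      next
        case 2
        show ?thesis
        proof (cases "A1 = B1")
          case True
          then have "A0 \<noteq> B0" using ne A(1) B(1) by blast
          then obtain K where K: "K \<in> circuits M" "K \<subseteq> A0 \<union> B0 - {p}"
            using elimM[OF A(2) B(2) A(4) B(4)] by blast
          then show ?thesis using 2 by (intro bexI[of _ K]) (auto simp: A(1) B(1))
        next
          case False
          obtain K where K: "K \<in> circuits N" "K \<subseteq> A1 \<union> B1 - {x}"
            using elimN[OF A(3) B(3) 2(1,2) False] by blast
          show ?thesis
          proof (cases "p \<in> K")
            case True
            then show ?thesis using XI[OF A(2) K(1) A(4) True] K(2) 2
              by (intro bexI[of _ "(A0 - {p}) \<union> (K - {p})"]) (auto simp: A(1) B(1))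
          next
            case False
            then show ?thesis using K by (intro bexI[of _ K]) (auto simp: A(1) B(1))
          qed
        qed
      qed
    qed
    have MM: "?R (A \<union> B - {x})" if "A \<in> circuits M" "B \<in> circuits M" "x \<in> A" "x \<in> B" "A \<noteq> B" for A B
      using elimM[OF that] by blast
    have NN: "?R (A \<union> B - {x})" if "A \<in> circuits N" "B \<in> circuits N" "x \<in> A" "x \<in> B" "A \<noteq> B" for A B
      using elimN[OF that] by blast
    consider "C \<in> circuits M" "D \<in> circuits M" | "C \<in> circuits M" "D \<in> circuits N" | "C \<in> circuits M" "D \<in> X"
      | "C \<in> circuits N" "D \<in> circuits M" | "C \<in> circuits N" "D \<in> circuits N" | "C \<in> circuits N" "D \<in> X"
      | "C \<in> X" "D \<in> circuits M" | "C \<in> X" "D \<in> circuits N" | "C \<in> X" "D \<in> X"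
      using C D by blast
    then show ?thesis
    proof cases
      case 1 then show ?thesis using x ne by (rule MM)
    next
      case 2 then show ?thesis using x by (rule cross)
    next
      case 3 then show ?thesis using x by (rule MX)
    next
      case 4 show ?thesis using cross[OF 4(2,1) x(2,1)] by (simp only: Un_commute[of D C])
    next
      case 5 then show ?thesis using x ne by (rule NN)
    next
      case 6 then show ?thesis using x by (rule NX)
    next
      case 7 show ?thesis using MX[OF 7(2,1) x(2,1)] by (simp only: Un_commute[of D C])
    next
      case 8 show ?thesis using NX[OF 8(2,1) x(2,1)] by (simp only: Un_commute[of D C])
    next
      case 9 then show ?thesis using x ne by (rule XX)
    qed
  qed
  have bigX: "\<exists>u v. u \<in> Z \<and> v \<in> Z \<and> w \<in> Z \<and> u \<noteq> v \<and> u \<noteq> w \<and> v \<noteq> w"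
    if Z: "Z \<in> X" "w \<in> Z" for Z w
  proof -
    obtain A0 A1 where A: "Z = (A0 - {p}) \<union> (A1 - {p})" "A0 \<in> circuits M" "A1 \<in> circuits N"
      using XE[OF Z(1)] by blast
    obtain a b c d where "a \<in> A0" "b \<in> A0" "a \<noteq> b" "a \<noteq> p" "b \<noteq> p" "c \<in> A1" "d \<in> A1" "c \<noteq> d" "c \<noteq> p" "d \<noteq> p"
      using bigM[OF A(2)] bigN[OF A(3)] by blast
    moreover from this have "a \<noteq> c" "a \<noteq> d" "b \<noteq> c" "b \<noteq> d"
      using subM[OF A(2)] subN[OF A(3)] common by blast+
    ultimately show ?thesis using A(1) Z(2) by blast
  qed
  have neX: "{} \<notin> X"
  proof
    assume "{} \<in> X"
    then obtain C where "C \<in> circuits M" "C - {p} = {}" using XE[of "{}"] by blast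
    then show False using bigM[of C] by blast
  qed
  have small: "{x, y} \<notin> circuits M \<union> circuits N \<union> X" for x y
    using M N bigX[of "{x, y}" x] unfolding simple_matroid_def by blast
  have "matroid (glue_at p M N)"
    unfolding matroid_def circ gr
  proof (intro conjI ballI impI)
    show "finite (ground M \<union> ground N)"
      using M N by (simp add: simple_matroid_def matroid_def)
    show "circuits M \<union> circuits N \<union> X \<subseteq> Pow (ground M \<union> ground N)"
      using subM subN XE by blast
    show "{} \<notin> circuits M \<union> circuits N \<union> X"
      using bigM[of "{}"] bigN[of "{}"] neX by auto
    fix C D assume CD: "C \<in> circuits M \<union> circuits N \<union> X" "D \<in> circuits M \<union> circuits N \<union> X"
    show "C = D" if "C \<subseteq> D" using anti[OF CD that] .
    show "\<exists>K\<in>circuits M \<union> circuits N \<union> X. K \<subseteq> C \<union> D - {x}" if "x \<in> C \<inter> D" "C \<noteq> D" for x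
      using elim[OF CD _ _ that(2)] that(1) by simp
  qed
  moreover have "{x} \<notin> circuits M \<union> circuits N \<union> X" for x
    using small[of x x] by simp
  ultimately show ?thesis
    unfolding simple_matroid_def circ using small by simp
qed

lemma simple_matroid_parallel_connection:
  assumes "simple_matroid M" "simple_matroid N" "ground M \<inter> ground N = {}"
    and "p0 \<in> ground M" "p1 \<in> ground N" "p \<notin> (ground M - {p0}) \<union> (ground N - {p1})"
  shows "simple_matroid (parallel_connection M p0 N p1 p)"
  unfolding parallel_connection_def
proof (rule simple_matroid_glue_at)
  show "simple_matroid (relabel (id(p0 := p)) M)" "simple_matroid (relabel (id(p1 := p)) N)"
    using assms by (auto intro!: simple_matroid_relabel simp: inj_on_def)
  show "ground (relabel (id(p0 := p)) M) \<inter> ground (relabel (id(p1 := p)) N) = {p}"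
    using assms by (auto simp: relabel_def)
qed


section \<open>Graded algebras over the complex numbers\<close>

text \<open>\<open>homog A n\<close> is the homogeneous component of degree \<open>n\<close>.\<close>

record 'b graded_algebra = "(complex, 'b) module" +
  homog :: "nat \<Rightarrow> 'b set"

definition graded_algebra_iso :: "'b graded_algebra \<Rightarrow> 'c graded_algebra \<Rightarrow> ('b \<Rightarrow> 'c) set" where
  "graded_algebra_iso A B =
     {h \<in> ring_iso A B.
        (\<forall>c. \<forall>x\<in>carrier A. h (c \<odot>\<^bsub>A\<^esub> x) = c \<odot>\<^bsub>B\<^esub> h x) \<and>
        (\<forall>n. h ` homog A n = homog B n)}"

definition graded_algebra_isomorphic ::
  "'b graded_algebra \<Rightarrow> 'c graded_algebra \<Rightarrow> bool" (infix \<open>\<cong>\<^sub>g\<^sub>r\<close> 50) where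
  "A \<cong>\<^sub>g\<^sub>r B \<longleftrightarrow> graded_algebra_iso A B \<noteq> {}"

text \<open>
  The ring structure is that of the factor ring. A two-sided ring ideal of a unital algebra is
  closed under scalars, so the scalar action descends; the degree \<open>n\<close> part is the image of the
  degree \<open>n\<close> part (used below for ideals with homogeneous generators only).
\<close>

definition quotient_algebra :: "'b graded_algebra \<Rightarrow> 'b set \<Rightarrow> 'b set graded_algebra" where
  "quotient_algebra A I =
     \<lparr>carrier = carrier (A Quot I),
      monoid.mult = monoid.mult (A Quot I),
      one = one (A Quot I),
      zero = zero (A Quot I),
      add = add (A Quot I),
      smult = (\<lambda>c X. \<Union>x\<in>X. I +>\<^bsub>A\<^esub> (c \<odot>\<^bsub>A\<^esub> x)),
      homog = (\<lambda>n. (\<lambda>x. I +>\<^bsub>A\<^esub> x) ` homog A n)\<rparr>"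

text \<open>
  The tensor algebra of the vector space with basis \<open>E\<close>: finitely supported complex functions on
  words over \<open>E\<close>. The product of \<^typ>\<open>'k \<Rightarrow>\<^sub>0 complex\<close> is convolution with respect to the addition
  of \<^typ>\<open>'k\<close>, so words are wrapped into a monoid whose \<open>+\<close> is concatenation.
\<close>

datatype 'a word = Word (letters: "'a list")

instantiation word :: (type) monoid_add
begin

definition zero_word :: "'a word" where
  "0 = Word []"

definition plus_word :: "'a word \<Rightarrow> 'a word \<Rightarrow> 'a word" where
  "u + v = Word (letters u @ letters v)"

instance
  by standard (simp_all add: zero_word_def plus_word_def)

end

definition tensor_carrier :: "'a set \<Rightarrow> ('a word \<Rightarrow>\<^sub>0 complex) set" where
  "tensor_carrier E = {f. \<forall>w\<in>Poly_Mapping.keys f. set (letters w) \<subseteq> E}"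

definition tensor_algebra :: "'a set \<Rightarrow> ('a word \<Rightarrow>\<^sub>0 complex) graded_algebra" where
  "tensor_algebra E =
     \<lparr>carrier = tensor_carrier E,
      monoid.mult = (*),
      one = 1,
      zero = 0,
      add = (+),
      smult = (\<lambda>c. Poly_Mapping.map ((*) c)),
      homog = (\<lambda>n. {f \<in> tensor_carrier E. \<forall>w\<in>Poly_Mapping.keys f. length (letters w) = n})\<rparr>"

text \<open>The exterior algebra is the tensor algebra modulo the squares of all vectors.\<close>

definition square_ideal :: "'a set \<Rightarrow> ('a word \<Rightarrow>\<^sub>0 complex) set" where
  "square_ideal E = genideal (tensor_algebra E) {v * v | v. v \<in> homog (tensor_algebra E) 1}"

definition exterior_algebra :: "'a set \<Rightarrow> ('a word \<Rightarrow>\<^sub>0 complex) set graded_algebra" where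
  "exterior_algebra E = quotient_algebra (tensor_algebra E) (square_ideal E)"

definition ext_gen :: "'a set \<Rightarrow> 'a \<Rightarrow> ('a word \<Rightarrow>\<^sub>0 complex) set" where
  "ext_gen E i = square_ideal E +>\<^bsub>tensor_algebra E\<^esub> Poly_Mapping.single (Word [i]) 1"

definition ext_monomial :: "'a set \<Rightarrow> 'a list \<Rightarrow> ('a word \<Rightarrow>\<^sub>0 complex) set" where
  "ext_monomial E S =
     foldr (\<lambda>i x. ext_gen E i \<otimes>\<^bsub>exterior_algebra E\<^esub> x) S \<one>\<^bsub>exterior_algebra E\<^esub>"

text \<open>
  \<open>boundary_monomial E S\<close> is \<open>\<partial> e\<^sub>S\<close>, with positions in \<open>S\<close> counted from 0; the derivation \<open>\<partial>\<close>
  enters only through these values.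
\<close>

definition boundary_monomial :: "'a set \<Rightarrow> 'a list \<Rightarrow> ('a word \<Rightarrow>\<^sub>0 complex) set" where
  "boundary_monomial E S =
     (\<Oplus>\<^bsub>exterior_algebra E\<^esub>k\<in>{..<length S}.
        (- 1) ^ k \<odot>\<^bsub>exterior_algebra E\<^esub> ext_monomial E (take k S @ drop (Suc k) S))"

definition orlik_solomon_ideal :: "'a circuit_system \<Rightarrow> ('a word \<Rightarrow>\<^sub>0 complex) set set" where
  "orlik_solomon_ideal H =
     genideal (exterior_algebra (ground H))
       {boundary_monomial (ground H) S | S. distinct S \<and> dependent H (set S)}"

definition orlik_solomon ::
  "'a circuit_system \<Rightarrow> ('a word \<Rightarrow>\<^sub>0 complex) set set graded_algebra" where
  "orlik_solomon H = quotient_algebra (exterior_algebra (ground H)) (orlik_solomon_ideal H)"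

lemma ring_tensor_algebra: "ring (tensor_algebra E)"
proof (rule ringI)
  have add: "x + y \<in> tensor_carrier E" if "x \<in> tensor_carrier E" "y \<in> tensor_carrier E" for x y
    using that Poly_Mapping.keys_add[of x y] by (force simp: tensor_carrier_def)
  have mult: "x * y \<in> tensor_carrier E" if "x \<in> tensor_carrier E" "y \<in> tensor_carrier E" for x y
    using that keys_mult[of x y] by (force simp: tensor_carrier_def plus_word_def)
  have uminus: "- x \<in> tensor_carrier E" if "x \<in> tensor_carrier E" for x
    using that by (simp add: tensor_carrier_def)
  have zero: "0 \<in> tensor_carrier E" by (simp add: tensor_carrier_def)
  have one: "1 \<in> tensor_carrier E"
    by (simp add: tensor_carrier_def zero_word_def)
  show "abelian_group (tensor_algebra E)"
  proof (rule abelian_groupI)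
    fix x assume "x \<in> carrier (tensor_algebra E)"
    then show "\<exists>y\<in>carrier (tensor_algebra E). y \<oplus>\<^bsub>tensor_algebra E\<^esub> x = \<zero>\<^bsub>tensor_algebra E\<^esub>"
      using uminus by (intro bexI[of _ "- x"]) (simp_all add: tensor_algebra_def)
  qed (simp_all add: tensor_algebra_def add zero ac_simps)
  show "Group.monoid (tensor_algebra E)"
    by (rule monoidI) (simp_all add: tensor_algebra_def mult one mult.assoc)
qed (simp_all add: tensor_algebra_def distrib_left distrib_right)

lemma ring_quotient_algebra:
  assumes "ideal I A"
  shows "ring (quotient_algebra A I)"
proof -
  interpret Q: ring "A Quot I"
    using assms by (rule ideal.quotient_is_ring)
  have eqs: "carrier (quotient_algebra A I) = carrier (A Quot I)"
    "monoid.mult (quotient_algebra A I) = monoid.mult (A Quot I)"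
    "one (quotient_algebra A I) = one (A Quot I)"
    "zero (quotient_algebra A I) = zero (A Quot I)"
    "add (quotient_algebra A I) = add (A Quot I)"
    by (simp_all add: quotient_algebra_def)
  show ?thesis
  proof (rule ringI)
    show "abelian_group (quotient_algebra A I)"
      by (rule abelian_groupI) (simp_all add: eqs Q.a_ac Q.add.l_inv_ex)
    show "Group.monoid (quotient_algebra A I)"
      by (rule monoidI) (simp_all add: eqs Q.m_assoc)
  qed (simp_all add: eqs Q.l_distr Q.r_distr)
qed

lemma ideal_square_ideal: "ideal (square_ideal E) (tensor_algebra E)"
proof -
  interpret T: ring "tensor_algebra E" by (rule ring_tensor_algebra)
  have "v * v \<in> carrier (tensor_algebra E)" if "v \<in> homog (tensor_algebra E) 1" for v
    using that T.m_closed[of v v] by (simp add: tensor_algebra_def)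
  then show ?thesis
    unfolding square_ideal_def by (intro T.genideal_ideal) blast
qed

lemma ring_exterior_algebra: "ring (exterior_algebra E)"
  unfolding exterior_algebra_def by (intro ring_quotient_algebra ideal_square_ideal)

lemma ext_gen_closed:
  assumes "i \<in> E"
  shows "ext_gen E i \<in> carrier (exterior_algebra E)"
proof -
  have "Poly_Mapping.single (Word [i]) 1 \<in> carrier (tensor_algebra E)"
    using assms by (simp add: tensor_algebra_def tensor_carrier_def)
  then show ?thesis
    by (auto simp: ext_gen_def exterior_algebra_def quotient_algebra_def FactRing_def A_RCOSETS_def')
qed

lemma ext_monomial_closed:
  assumes "set S \<subseteq> E"
  shows "ext_monomial E S \<in> carrier (exterior_algebra E)"
proof -
  interpret X: ring "exterior_algebra E" by (rule ring_exterior_algebra)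
  show ?thesis
    using assms by (induction S) (auto simp: ext_monomial_def ext_gen_closed)
qed

lemma smult_quotient_algebra:
  assumes I: "ideal I A"
    and smult: "\<And>x y. x \<in> carrier A \<Longrightarrow> y \<in> carrier A \<Longrightarrow> c \<odot>\<^bsub>A\<^esub> (x \<oplus>\<^bsub>A\<^esub> y) = c \<odot>\<^bsub>A\<^esub> x \<oplus>\<^bsub>A\<^esub> c \<odot>\<^bsub>A\<^esub> y"
      "\<And>x. x \<in> carrier A \<Longrightarrow> c \<odot>\<^bsub>A\<^esub> x \<in> carrier A"
      "\<And>x. x \<in> carrier A \<Longrightarrow> c \<odot>\<^bsub>A\<^esub> x = (c \<odot>\<^bsub>A\<^esub> \<one>\<^bsub>A\<^esub>) \<otimes>\<^bsub>A\<^esub> x"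
    and x: "x \<in> carrier A"
  shows "c \<odot>\<^bsub>quotient_algebra A I\<^esub> (I +>\<^bsub>A\<^esub> x) = I +>\<^bsub>A\<^esub> (c \<odot>\<^bsub>A\<^esub> x)"
proof -
  interpret ideal I A by (rule I)
  have coset: "I +>\<^bsub>A\<^esub> (c \<odot>\<^bsub>A\<^esub> y) = I +>\<^bsub>A\<^esub> (c \<odot>\<^bsub>A\<^esub> x)" if y: "y \<in> I +>\<^bsub>A\<^esub> x" for y
  proof -
    obtain h where h: "h \<in> I" "y = h \<oplus>\<^bsub>A\<^esub> x" using y by (auto simp: a_r_coset_def')
    have "c \<odot>\<^bsub>A\<^esub> h \<in> I"
      using I_l_closed[OF h(1), of "c \<odot>\<^bsub>A\<^esub> \<one>\<^bsub>A\<^esub>"] smult(2)[of "\<one>\<^bsub>A\<^esub>"] smult(3)[of h] h(1)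
      by (simp add: a_Hcarr)
    moreover have "c \<odot>\<^bsub>A\<^esub> y = c \<odot>\<^bsub>A\<^esub> h \<oplus>\<^bsub>A\<^esub> c \<odot>\<^bsub>A\<^esub> x"
      using smult(1) h x by (simp add: a_Hcarr)
    ultimately have "c \<odot>\<^bsub>A\<^esub> y \<in> I +>\<^bsub>A\<^esub> (c \<odot>\<^bsub>A\<^esub> x)"
      by (auto simp: a_r_coset_def')
    then show ?thesis
      using a_repr_independence[OF _ smult(2)[OF x] a_subgroup] by simp
  qed
  have "x \<in> I +>\<^bsub>A\<^esub> x" using x by (rule a_rcos_self)
  have "(\<Union>y\<in>I +>\<^bsub>A\<^esub> x. I +>\<^bsub>A\<^esub> (c \<odot>\<^bsub>A\<^esub> y)) = I +>\<^bsub>A\<^esub> (c \<odot>\<^bsub>A\<^esub> x)"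
    by (rule UN_constant_eq[OF \<open>x \<in> I +>\<^bsub>A\<^esub> x\<close>]) (intro ballI coset)
  then show ?thesis
    by (simp only: quotient_algebra_def module.simps)
qed

lemma smult_tensor_algebra:
  "c \<odot>\<^bsub>tensor_algebra E\<^esub> x = Poly_Mapping.single 0 c * x"
  by (simp add: tensor_algebra_def mult_map_scale_conv_mult)

lemma smult_tensor_algebra_closed:
  assumes "x \<in> carrier (tensor_algebra E)"
  shows "c \<odot>\<^bsub>tensor_algebra E\<^esub> x \<in> carrier (tensor_algebra E)"
proof -
  interpret T: ring "tensor_algebra E" by (rule ring_tensor_algebra)
  have "Poly_Mapping.single 0 c \<in> carrier (tensor_algebra E)"
    by (simp add: tensor_algebra_def tensor_carrier_def zero_word_def)
  from T.m_closed[OF this assms] show ?thesis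
    unfolding smult_tensor_algebra by (simp add: tensor_algebra_def)
qed

lemma smult_exterior_algebra:
  assumes "x \<in> carrier (tensor_algebra E)"
  shows "c \<odot>\<^bsub>exterior_algebra E\<^esub> (square_ideal E +>\<^bsub>tensor_algebra E\<^esub> x) =
    square_ideal E +>\<^bsub>tensor_algebra E\<^esub> (c \<odot>\<^bsub>tensor_algebra E\<^esub> x)"
  unfolding exterior_algebra_def
proof (rule smult_quotient_algebra[OF ideal_square_ideal _ smult_tensor_algebra_closed _ assms])
  fix x y :: "'a word \<Rightarrow>\<^sub>0 complex"
  show "c \<odot>\<^bsub>tensor_algebra E\<^esub> (x \<oplus>\<^bsub>tensor_algebra E\<^esub> y) =
      c \<odot>\<^bsub>tensor_algebra E\<^esub> x \<oplus>\<^bsub>tensor_algebra E\<^esub> c \<odot>\<^bsub>tensor_algebra E\<^esub> y"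
    unfolding smult_tensor_algebra by (simp add: tensor_algebra_def distrib_left)
  show "c \<odot>\<^bsub>tensor_algebra E\<^esub> x =
      (c \<odot>\<^bsub>tensor_algebra E\<^esub> \<one>\<^bsub>tensor_algebra E\<^esub>) \<otimes>\<^bsub>tensor_algebra E\<^esub> x"
    unfolding smult_tensor_algebra by (simp add: tensor_algebra_def)
qed

lemma smult_exterior_algebra_closed:
  assumes "X \<in> carrier (exterior_algebra E)"
  shows "c \<odot>\<^bsub>exterior_algebra E\<^esub> X \<in> carrier (exterior_algebra E)"
proof -
  have car: "carrier (exterior_algebra E) =
      (\<lambda>x. square_ideal E +>\<^bsub>tensor_algebra E\<^esub> x) ` carrier (tensor_algebra E)"
    by (auto simp: exterior_algebra_def quotient_algebra_def FactRing_def A_RCOSETS_def')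
  show ?thesis
    using assms smult_exterior_algebra smult_tensor_algebra_closed unfolding car by force
qed

lemma boundary_monomial_closed:
  assumes "set S \<subseteq> E"
  shows "boundary_monomial E S \<in> carrier (exterior_algebra E)"
proof -
  interpret X: ring "exterior_algebra E" by (rule ring_exterior_algebra)
  have "set (take k S @ drop (Suc k) S) \<subseteq> E" for k
    using assms set_take_subset[of k S] set_drop_subset[of "Suc k" S] by auto
  then show ?thesis
    unfolding boundary_monomial_def
    by (intro X.finsum_closed Pi_I smult_exterior_algebra_closed ext_monomial_closed)
qed

lemma ideal_orlik_solomon_ideal: "ideal (orlik_solomon_ideal H) (exterior_algebra (ground H))"
proof -
  interpret X: ring "exterior_algebra (ground H)" by (rule ring_exterior_algebra)
  show ?thesis
    unfolding orlik_solomon_ideal_def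
    by (intro X.genideal_ideal) (auto simp: dependent_def intro!: boundary_monomial_closed)
qed

lemma ring_orlik_solomon: "ring (orlik_solomon H)"
  unfolding orlik_solomon_def by (intro ring_quotient_algebra ideal_orlik_solomon_ideal)

end

theory Submission
  imports Defs "HOL-Library.Multiset"
begin

text \<open>
  The boundary of \<open>e\<^sub>S\<close> depends only on the differences of the generators indexed by \<open>S\<close>. Hence the
  linear substitution \<open>e\<^sub>i \<mapsto> e\<^sub>i\<close> for \<open>i\<close> in \<open>G0\<close> and \<open>e\<^sub>j \<mapsto> e\<^sub>j + (e\<^sub>z - e\<^sub>p)\<close> for \<open>j\<close> in \<open>G1\<close>, where
  \<open>p0\<close> and \<open>p1\<close> are read as \<open>p\<close> on the right, carries the circuit relations of \<open>G0\<close> and \<open>G1\<close> to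
  those of the two parts of the parallel connection. It is invertible, with \<open>e\<^sub>z\<close> the image of the
  generator at \<open>p1\<close>. The remaining circuits \<open>(C - {p}) \<union> (D - {p})\<close> of the parallel connection give
  nothing new: the boundary of \<open>e\<^sub>X e\<^sub>Y\<close> lies in the ideal generated by the boundaries of \<open>e\<^sub>X e\<^sub>p\<close> and
  \<open>e\<^sub>p e\<^sub>Y\<close>. All computations take place in tensor algebras, modulo ideals containing the squares of
  vectors.
\<close>

section \<open>Boundaries of products modulo squares\<close>

text \<open>The boundary is a function of the list and not of its product, so it is well defined
  before any relation is imposed. The recursion is the Leibniz rule of the odd derivation that sends
  every entry to 1.\<close>

fun boundary :: "'r::ring_1 list \<Rightarrow> 'r" where
  "boundary [] = 0"
| "boundary (v # vs) = prod_list vs - v * boundary vs"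

lemma boundary_append:
  "boundary (us @ vs) = boundary us * prod_list vs + (- 1) ^ length us * prod_list us * boundary vs"
  by (induction us) (auto simp: algebra_simps minus_one_power_iff)

text \<open>Puts the recursion into the alternating form of \<open>boundary_monomial\<close>, with
  positions counted from 0.\<close>

lemma boundary_sum:
  "boundary vs = (\<Sum>k<length vs. (- 1) ^ k * prod_list (take k vs @ drop (Suc k) vs))"
proof (induction vs)
  case (Cons v vs)
  have "(\<Sum>k<length (v # vs). (- 1) ^ k * prod_list (take k (v # vs) @ drop (Suc k) (v # vs)))
      = prod_list vs - (\<Sum>k<length vs. (- 1) ^ k * (v * prod_list (take k vs @ drop (Suc k) vs)))"
    by (simp only: length_Cons sum.lessThan_Suc_shift) (simp add: sum_negf mult.assoc)
  also have "(\<Sum>k<length vs. (- 1) ^ k * (v * prod_list (take k vs @ drop (Suc k) vs)))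
      = v * boundary vs"
    unfolding Cons.IH sum_distrib_left
    by (intro sum.cong) (auto simp: minus_one_power_iff)
  finally show ?case by simp
qed simp

text \<open>\<open>R\<close> is meant to be the tensor algebra on a ground set, \<open>V\<close> its
  degree one part and \<open>K\<close> an ideal of \<open>R\<close> containing the squares of
  vectors. Membership in \<open>K\<close> replaces equality in the quotient, so computations remain
  identities in the ambient ring type.\<close>

locale square_zero_ideal =
  fixes R V K :: "'r::ring_1 set"
  assumes one_R: "1 \<in> R"
    and add_R: "x \<in> R \<Longrightarrow> y \<in> R \<Longrightarrow> x + y \<in> R"
    and uminus_R: "x \<in> R \<Longrightarrow> - x \<in> R"
    and mult_R: "x \<in> R \<Longrightarrow> y \<in> R \<Longrightarrow> x * y \<in> R"
    and V_R: "v \<in> V \<Longrightarrow> v \<in> R"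
    and add_V: "u \<in> V \<Longrightarrow> v \<in> V \<Longrightarrow> u + v \<in> V"
    and zero_K: "0 \<in> K"
    and add_K: "x \<in> K \<Longrightarrow> y \<in> K \<Longrightarrow> x + y \<in> K"
    and uminus_K: "x \<in> K \<Longrightarrow> - x \<in> K"
    and mult_left_K: "x \<in> R \<Longrightarrow> y \<in> K \<Longrightarrow> x * y \<in> K"
    and mult_right_K: "x \<in> K \<Longrightarrow> y \<in> R \<Longrightarrow> x * y \<in> K"
    and square_K: "v \<in> V \<Longrightarrow> v * v \<in> K"
begin

lemma diff_R: "x \<in> R \<Longrightarrow> y \<in> R \<Longrightarrow> x - y \<in> R"
  using add_R[OF _ uminus_R] by force

lemma zero_R: "0 \<in> R"
  using diff_R[OF one_R one_R] by simp

lemma diff_K: "x \<in> K \<Longrightarrow> y \<in> K \<Longrightarrow> x - y \<in> K"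
  using add_K[OF _ uminus_K] by force

lemma mem_K_iff: "x - y \<in> K \<Longrightarrow> x \<in> K \<longleftrightarrow> y \<in> K"
  using add_K[of "x - y" y] diff_K[of x "x - y"] by auto

text \<open>Polarization of \<open>square_K\<close>: expand the square of the sum.\<close>

lemma anticommute_K:
  assumes "u \<in> V" "v \<in> V"
  shows "u * v + v * u \<in> K"
proof -
  have "u * v + v * u = (u + v) * (u + v) - u * u - v * v"
    by (simp add: algebra_simps)
  then show ?thesis
    using assms by (simp add: diff_K square_K add_V)
qed

lemma prod_list_R: "set vs \<subseteq> V \<Longrightarrow> prod_list vs \<in> R"
  by (induction vs) (auto simp: one_R mult_R V_R)

lemma boundary_R: "set vs \<subseteq> V \<Longrightarrow> boundary vs \<in> R"
  by (induction vs) (auto simp: zero_R diff_R mult_R V_R prod_list_R)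

text \<open>Both conditions are carried together because the boundary of \<open>v # vs\<close>
  involves the product of \<open>vs\<close>: it is the pair that is visibly stable under prepending
  vectors.\<close>

definition null_list :: "'r list \<Rightarrow> bool" where
  "null_list vs \<longleftrightarrow> prod_list vs \<in> K \<and> boundary vs \<in> K"

section \<open>Sign changes and invariance under reordering\<close>

lemma swap_K:
  assumes "set us \<subseteq> V" "u \<in> V" "v \<in> V" "set ws \<subseteq> V"
  shows "prod_list (us @ u # v # ws) + prod_list (us @ v # u # ws) \<in> K"
    and "boundary (us @ u # v # ws) + boundary (us @ v # u # ws) \<in> K"
proof -
  have "prod_list (us @ u # v # ws) + prod_list (us @ v # u # ws) \<in> K \<and>
      boundary (us @ u # v # ws) + boundary (us @ v # u # ws) \<in> K"
    using assms(1)
  proof (induction us)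
    case Nil
    \<comment> \<open>Both sums have the form \<open>(u * v + v * u) * x\<close>, with
      \<open>x\<close> the product of \<open>ws\<close> in one case and its boundary in the other.
      In the second case the terms containing only one of \<open>u\<close> and \<open>v\<close>
      cancel.\<close>
    have "(u * v + v * u) * x \<in> K" if "x \<in> R" for x
      using anticommute_K[OF assms(2,3)] that by (rule mult_right_K)
    from this[OF prod_list_R[OF assms(4)]] this[OF boundary_R[OF assms(4)]]
    show ?case by (simp add: algebra_simps)
  next
    case (Cons w us)
    let ?l = "us @ u # v # ws" and ?r = "us @ v # u # ws"
    have "w \<in> R" using Cons.prems by (simp add: V_R)
    then have "w * (prod_list ?l + prod_list ?r) \<in> K"
      "prod_list ?l + prod_list ?r - w * (boundary ?l + boundary ?r) \<in> K"
      using Cons by (auto intro: diff_K mult_left_K)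
    then show ?case by (simp add: algebra_simps)
  qed
  then show "prod_list (us @ u # v # ws) + prod_list (us @ v # u # ws) \<in> K"
    and "boundary (us @ u # v # ws) + boundary (us @ v # u # ws) \<in> K" by auto
qed

lemma null_list_swap:
  assumes "set us \<subseteq> V" "u \<in> V" "v \<in> V" "set ws \<subseteq> V"
  shows "null_list (us @ u # v # ws) \<longleftrightarrow> null_list (us @ v # u # ws)"
proof -
  have "x \<in> K \<longleftrightarrow> y \<in> K" if "x + y \<in> K" for x y
    using diff_K[OF that, of x] diff_K[OF that, of y] by auto
  from this[OF swap_K(1)[OF assms]] this[OF swap_K(2)[OF assms]]
  show ?thesis by (simp add: null_list_def)
qed

lemma null_list_move_front:
  assumes "set us \<subseteq> V" "v \<in> V" "set ws \<subseteq> V"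
  shows "null_list (us @ v # ws) \<longleftrightarrow> null_list (v # us @ ws)"
  using assms
proof (induction us arbitrary: ws rule: rev_induct)
  case (snoc u us)
  then show ?case using null_list_swap[of us u v ws] by simp
qed simp

lemma null_list_perm:
  assumes "mset us = mset vs" "set vs \<subseteq> V"
  shows "null_list us \<longleftrightarrow> null_list vs"
proof -
  \<comment> \<open>A prefix \<open>ps\<close> is carried along so that the induction hypothesis
    applies behind a common head.\<close>
  have "null_list (ps @ us) \<longleftrightarrow> null_list (ps @ vs)" if "set ps \<subseteq> V" for ps
    using assms that
  proof (induction us arbitrary: ps vs)
    case (Cons u us)
    then have "u \<in> set vs" by (metis list.set_intros(1) set_mset_mset)
    then obtain as bs where vs: "vs = as @ u # bs" by (meson split_list)
    with Cons.prems have V: "set as \<subseteq> V" "set bs \<subseteq> V" "u \<in> V"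
      and us: "mset us = mset (as @ bs)" by auto
    have "null_list (ps @ u # us) \<longleftrightarrow> null_list (ps @ u # as @ bs)"
      using Cons.IH[OF us, of "ps @ [u]"] V Cons.prems by simp
    also have "\<dots> \<longleftrightarrow> null_list (ps @ vs)"
      using null_list_move_front[of ps u "as @ bs"] null_list_move_front[of "ps @ as" u bs]
        V Cons.prems vs by simp
    finally show ?case by simp
  qed simp
  from this[of "[]"] show ?thesis by simp
qed

lemma null_list_append_left:
  assumes "set us \<subseteq> V" "null_list vs"
  shows "null_list (us @ vs)"
  using assms by (induction us) (auto simp: null_list_def diff_K mult_left_K V_R)

text \<open>Multiplying the boundary by the head entry gives back the product up to a square. The
  empty list is excluded since its boundary is 0 and its product is 1.\<close>

lemma boundary_K_imp_prod_list_K: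
  assumes "boundary vs \<in> K" "set vs \<subseteq> V" "vs \<noteq> []"
  shows "prod_list vs \<in> K"
proof (cases vs)
  case (Cons v ws)
  have "prod_list vs = v * boundary vs + v * v * boundary ws"
    by (simp add: Cons algebra_simps)
  then show ?thesis
    using assms Cons by (auto simp: add_K mult_left_K mult_right_K square_K boundary_R V_R)
qed (use assms in simp)

text \<open>Passes from a circuit to a dependent set containing it: the enumeration can be reordered
  to put the circuit last, and prepended vectors preserve nullity.\<close>

lemma null_list_filter:
  assumes "null_list (map g xs)" "distinct xs" "distinct ys" "set xs \<subseteq> set ys" "g ` set ys \<subseteq> V"
  shows "null_list (map g ys)"
proof -
  let ?zs = "filter (\<lambda>y. y \<notin> set xs) ys"
  have "mset ys = mset (?zs @ xs)"
    using assms(2-4) by (subst set_eq_iff_mset_eq_distinct[symmetric]) auto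
  then have "mset (map g ys) = mset (map g ?zs @ map g xs)"
    by (metis map_append mset_map)
  moreover have "null_list (map g ?zs @ map g xs)"
    using assms by (intro null_list_append_left) auto
  ultimately show ?thesis
    using null_list_perm[of "map g ys" "map g ?zs @ map g xs"] assms(4,5) by auto
qed

text \<open>In the expanded product, terms with two copies of \<open>t\<close> vanish modulo
  \<open>K\<close>, and a single \<open>t\<close> moves to the front with the sign of its position,
  which yields \<open>t * boundary vs\<close>. Similar cancellations leave the boundary
  unchanged.\<close>

lemma translate_K:
  assumes "set vs \<subseteq> V" "t \<in> V"
  shows "prod_list (map (\<lambda>v. v + t) vs) - (prod_list vs + t * boundary vs) \<in> K"
    and "boundary (map (\<lambda>v. v + t) vs) - boundary vs \<in> K"
proof -
  have "prod_list (map (\<lambda>v. v + t) vs) - (prod_list vs + t * boundary vs) \<in> K \<and>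
      boundary (map (\<lambda>v. v + t) vs) - boundary vs \<in> K"
    using assms(1)
  proof (induction vs)
    case (Cons v vs)
    let ?P = "prod_list vs" and ?B = "boundary vs"
      and ?P' = "prod_list (map (\<lambda>v. v + t) vs)" and ?B' = "boundary (map (\<lambda>v. v + t) vs)"
    have IH: "?P' - (?P + t * ?B) \<in> K" "?B' - ?B \<in> K" and v: "v \<in> V" "set vs \<subseteq> V"
      using Cons by auto
    have vt: "v + t \<in> R" using v(1) assms(2) by (simp add: V_R add_R)
    \<comment> \<open>This is the product claim for \<open>v # vs\<close>, rewritten so that the
      errors are an anticommutator and a square.\<close>
    have "(v + t) * (?P' - (?P + t * ?B)) + (v * t + t * v) * ?B + t * t * ?B \<in> K"
      using mult_left_K[OF vt IH(1)] anticommute_K[OF v(1) assms(2)] square_K[OF assms(2)]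
        boundary_R[OF v(2)] by (metis add_K mult_right_K)
    \<comment> \<open>This is the boundary claim: the \<open>t * ?B\<close> from the product
      congruence cancels the \<open>t * ?B\<close> that the factor \<open>v + t\<close> creates in
      front of \<open>?B\<close>.\<close>
    moreover have "?P' - (?P + t * ?B) - (v + t) * (?B' - ?B) \<in> K"
      using vt IH by (auto intro!: diff_K mult_left_K)
    ultimately show ?case by (simp add: algebra_simps)
  qed (simp add: zero_K)
  then show "prod_list (map (\<lambda>v. v + t) vs) - (prod_list vs + t * boundary vs) \<in> K"
    and "boundary (map (\<lambda>v. v + t) vs) - boundary vs \<in> K" by auto
qed

lemma null_list_translate:
  assumes "set vs \<subseteq> V" "t \<in> V" "null_list vs"
  shows "null_list (map (\<lambda>v. v + t) vs)"
proof -
  have "prod_list vs + t * boundary vs \<in> K"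
    using assms by (auto simp: null_list_def add_K mult_left_K V_R)
  then show ?thesis
    using mem_K_iff[OF translate_K(1)] mem_K_iff[OF translate_K(2)] assms
    by (simp add: null_list_def)
qed

text \<open>
  This is why the circuits of a parallel connection that pass through both sides impose no
  relation beyond those of the circuits through the base point \<open>q\<close>.
\<close>

lemma null_list_glue:
  assumes "null_list (q # us)" "null_list (q # vs)" "q \<in> V" "set us \<subseteq> V" "set vs \<subseteq> V"
  shows "null_list (us @ vs)"
proof -
  have "null_list (us @ [q])"
    using null_list_move_front[of us q "[]"] assms by simp
  \<comment> \<open>In both identities the contributions with \<open>q\<close> in the middle cancel,
    and each summand has a factor in \<open>K\<close>: the product or boundary of
    \<open>us @ [q]\<close>, or the boundary of \<open>q # vs\<close>.\<close>
  moreover have "prod_list (us @ vs) =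
      prod_list (us @ [q]) * boundary vs + prod_list us * boundary (q # vs)"
    by (simp add: algebra_simps)
  moreover have "boundary (us @ vs) =
      boundary (us @ [q]) * boundary vs + boundary us * boundary (q # vs)"
    by (simp add: boundary_append algebra_simps)
  ultimately show ?thesis
    using assms prod_list_R[of us] boundary_R[of us] boundary_R[of vs]
    by (simp add: null_list_def add_K mult_left_K mult_right_K del: prod_list.append boundary.simps)
qed

end

section \<open>Substitution in tensor algebras\<close>

abbreviation letter :: "'a \<Rightarrow> 'a word \<Rightarrow>\<^sub>0 complex" where
  "letter i \<equiv> Poly_Mapping.single (Word [i]) 1"

abbreviation scalar :: "complex \<Rightarrow> 'a word \<Rightarrow>\<^sub>0 complex" where
  "scalar c \<equiv> Poly_Mapping.single 0 c"

text \<open>The algebra homomorphism that the universal property of the free algebra attaches to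
  \<open>g\<close>. It is defined on the whole type; ground sets enter only when closure is
  proved.\<close>

definition substitute ::
  "('a \<Rightarrow> 'b word \<Rightarrow>\<^sub>0 complex) \<Rightarrow> ('a word \<Rightarrow>\<^sub>0 complex) \<Rightarrow> 'b word \<Rightarrow>\<^sub>0 complex" where
  "substitute g f = (\<Sum>w\<in>Poly_Mapping.keys f.
     scalar (Poly_Mapping.lookup f w) * prod_list (map g (letters w)))"

lemma prod_list_letter: "prod_list (map letter l) = Poly_Mapping.single (Word l) 1"
  by (induction l) (simp_all add: mult_single plus_word_def flip: zero_word_def)

lemma sum_monomials:
  "f = (\<Sum>w\<in>Poly_Mapping.keys f. Poly_Mapping.single w (Poly_Mapping.lookup f w))"
  for f :: "'k \<Rightarrow>\<^sub>0 'c::comm_monoid_add"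
  by (rule poly_mapping_eqI)
    (auto simp: lookup_sum lookup_single when_def not_in_keys_iff_lookup_eq_zero sum.delta)

text \<open>Convolution over words is not commutative, but the empty word is central and the
  coefficients commute.\<close>

lemma scalar_commute: "scalar c * f = f * scalar c"
  by (subst (1 2) sum_monomials[of f])
    (simp add: sum_distrib_left sum_distrib_right mult_single mult.commute)

text \<open>Allows two elements and their sum to be expanded over one index set, although
  cancellation may shrink the support of the sum.\<close>

lemma substitute_superset:
  assumes "finite W" "Poly_Mapping.keys f \<subseteq> W"
  shows "substitute g f = (\<Sum>w\<in>W. scalar (Poly_Mapping.lookup f w) * prod_list (map g (letters w)))"
  unfolding substitute_def
  using assms by (intro sum.mono_neutral_left) (auto simp: not_in_keys_iff_lookup_eq_zero)

lemma substitute_zero [simp]: "substitute g 0 = 0"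
  by (simp add: substitute_def)

lemma substitute_add: "substitute g (f + h) = substitute g f + substitute g h"
proof -
  let ?W = "Poly_Mapping.keys f \<union> Poly_Mapping.keys h"
  have "Poly_Mapping.keys (f + h) \<subseteq> ?W" by (rule Poly_Mapping.keys_add)
  then show ?thesis
    by (simp add: substitute_superset[of ?W] lookup_add single_add distrib_right sum.distrib)
qed

lemma substitute_sum: "substitute g (\<Sum>x\<in>X. f x) = (\<Sum>x\<in>X. substitute g (f x))"
  by (induction X rule: infinite_finite_induct) (simp_all add: substitute_add)

lemma substitute_single:
  "substitute g (Poly_Mapping.single w c) = scalar c * prod_list (map g (letters w))"
  by (simp add: substitute_superset[of "{w}"])

lemma substitute_mult: "substitute g (f * h) = substitute g f * substitute g h"
proof -
  have single: "substitute g (Poly_Mapping.single v c * Poly_Mapping.single w d) =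
      substitute g (Poly_Mapping.single v c) * substitute g (Poly_Mapping.single w d)" for v w c d
  proof -
    let ?v = "prod_list (map g (letters v))" and ?w = "prod_list (map g (letters w))"
    \<comment> \<open>On monomials, multiplicativity amounts to moving the coefficient
      \<open>d\<close> past \<open>?v\<close>.\<close>
    have "scalar (c * d) * (?v * ?w) = scalar c * (scalar d * ?v) * ?w"
      by (simp add: mult_single flip: mult.assoc)
    also have "\<dots> = scalar c * (?v * scalar d) * ?w"
      by (simp only: scalar_commute)
    finally show ?thesis
      by (simp add: mult_single substitute_single plus_word_def mult.assoc)
  qed
  show ?thesis
    by (subst (1) sum_monomials[of f], subst (1) sum_monomials[of h],
        subst (3) sum_monomials[of f], subst (3) sum_monomials[of h])
      (simp add: sum_product substitute_sum single)
qed

section \<open>The carrier of the tensor algebra and its grading\<close>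

lemma tensor_algebra_simps [simp]:
  "carrier (tensor_algebra E) = tensor_carrier E"
  "monoid.mult (tensor_algebra E) = (*)"
  "one (tensor_algebra E) = 1"
  "zero (tensor_algebra E) = 0"
  "add (tensor_algebra E) = (+)"
  by (simp_all add: tensor_algebra_def)

lemma homog_tensor_iff:
  "f \<in> homog (tensor_algebra E) n \<longleftrightarrow>
     (\<forall>w\<in>Poly_Mapping.keys f. set (letters w) \<subseteq> E \<and> length (letters w) = n)"
  by (auto simp: tensor_algebra_def tensor_carrier_def)

lemma homog_tensor_carrier: "f \<in> homog (tensor_algebra E) n \<Longrightarrow> f \<in> tensor_carrier E"
  by (simp add: tensor_algebra_def)

lemma tensor_carrier_ring:
  shows zero_tensor_carrier: "0 \<in> tensor_carrier E"
    and one_tensor_carrier: "1 \<in> tensor_carrier E"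
    and add_tensor_carrier:
      "\<And>x y. x \<in> tensor_carrier E \<Longrightarrow> y \<in> tensor_carrier E \<Longrightarrow> x + y \<in> tensor_carrier E"
    and mult_tensor_carrier:
      "\<And>x y. x \<in> tensor_carrier E \<Longrightarrow> y \<in> tensor_carrier E \<Longrightarrow> x * y \<in> tensor_carrier E"
    and uminus_tensor_carrier: "\<And>x. x \<in> tensor_carrier E \<Longrightarrow> - x \<in> tensor_carrier E"
proof -
  interpret T: ring "tensor_algebra E" by (rule ring_tensor_algebra)
  show "0 \<in> tensor_carrier E" "1 \<in> tensor_carrier E"
    using T.zero_closed T.one_closed by simp_all
  show "x + y \<in> tensor_carrier E" "x * y \<in> tensor_carrier E"
    if "x \<in> tensor_carrier E" "y \<in> tensor_carrier E" for x y
    using that T.a_closed[of x y] T.m_closed[of x y] by simp_all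
  show "- x \<in> tensor_carrier E" if "x \<in> tensor_carrier E" for x
    using that by (simp add: tensor_carrier_def)
qed

lemma diff_tensor_carrier:
  "x \<in> tensor_carrier E \<Longrightarrow> y \<in> tensor_carrier E \<Longrightarrow> x - y \<in> tensor_carrier E"
  using add_tensor_carrier[OF _ uminus_tensor_carrier] by force

lemma scalar_tensor_carrier: "scalar c \<in> tensor_carrier E"
  by (simp add: tensor_carrier_def zero_word_def)

lemma sum_tensor_carrier:
  "(\<And>x. x \<in> X \<Longrightarrow> f x \<in> tensor_carrier E) \<Longrightarrow> (\<Sum>x\<in>X. f x) \<in> tensor_carrier E"
  by (induction X rule: infinite_finite_induct)
    (simp_all add: zero_tensor_carrier add_tensor_carrier)

lemma prod_list_tensor_carrier:
  "set l \<subseteq> tensor_carrier E \<Longrightarrow> prod_list l \<in> tensor_carrier E"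
  by (induction l) (simp_all add: one_tensor_carrier mult_tensor_carrier)

lemma a_inv_tensor_algebra:
  assumes "x \<in> tensor_carrier E"
  shows "\<ominus>\<^bsub>tensor_algebra E\<^esub> x = - x"
proof -
  interpret T: ring "tensor_algebra E" by (rule ring_tensor_algebra)
  show ?thesis using T.minus_equality[of "- x" x] assms by (simp add: uminus_tensor_carrier)
qed

lemma a_minus_tensor_algebra:
  assumes "y \<in> tensor_carrier E"
  shows "x \<ominus>\<^bsub>tensor_algebra E\<^esub> y = x - y"
  using assms by (simp add: a_minus_def a_inv_tensor_algebra)

lemma homog_tensor_zero: "0 \<in> homog (tensor_algebra E) n"
  by (simp add: homog_tensor_iff)

lemma homog_tensor_add:
  assumes "x \<in> homog (tensor_algebra E) n" "y \<in> homog (tensor_algebra E) n"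
  shows "x + y \<in> homog (tensor_algebra E) n"
  using assms Poly_Mapping.keys_add[of x y] unfolding homog_tensor_iff by blast

lemma homog_tensor_diff:
  assumes "x \<in> homog (tensor_algebra E) n" "y \<in> homog (tensor_algebra E) n"
  shows "x - y \<in> homog (tensor_algebra E) n"
proof -
  have "- y \<in> homog (tensor_algebra E) n" using assms(2) by (simp add: homog_tensor_iff)
  from homog_tensor_add[OF assms(1) this] show ?thesis by simp
qed

lemma homog_tensor_mult:
  assumes "x \<in> homog (tensor_algebra E) m" "y \<in> homog (tensor_algebra E) n"
  shows "x * y \<in> homog (tensor_algebra E) (m + n)"
  unfolding homog_tensor_iff
proof
  fix w assume "w \<in> Poly_Mapping.keys (x * y)"
  then obtain u v where "u \<in> Poly_Mapping.keys x" "v \<in> Poly_Mapping.keys y" "w = u + v"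
    using keys_mult[of x y] by blast
  then show "set (letters w) \<subseteq> E \<and> length (letters w) = m + n"
    using assms unfolding homog_tensor_iff by (auto simp: plus_word_def)
qed

lemma homog_tensor_scalar: "scalar c \<in> homog (tensor_algebra E) 0"
  by (simp add: homog_tensor_iff zero_word_def)

lemma homog_tensor_letter: "i \<in> E \<Longrightarrow> letter i \<in> homog (tensor_algebra E) 1"
  by (simp add: homog_tensor_iff)

lemma homog_tensor_sum:
  "(\<And>x. x \<in> X \<Longrightarrow> f x \<in> homog (tensor_algebra E) n) \<Longrightarrow>
    (\<Sum>x\<in>X. f x) \<in> homog (tensor_algebra E) n"
  by (induction X rule: infinite_finite_induct) (simp_all add: homog_tensor_zero homog_tensor_add)

lemma homog_tensor_prod_list:
  "set l \<subseteq> homog (tensor_algebra E) 1 \<Longrightarrow> prod_list l \<in> homog (tensor_algebra E) (length l)"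
proof (induction l)
  case Nil
  then show ?case using homog_tensor_scalar[of 1] by simp
next
  case (Cons x l)
  then show ?case using homog_tensor_mult[of x E 1 "prod_list l" "length l"] by simp
qed

section \<open>Substitution as a graded homomorphism\<close>

lemma substitute_uminus: "substitute g (- f) = - substitute g f"
  using substitute_add[of g f "- f"] by (simp add: eq_neg_iff_add_eq_0 add.commute)

lemma substitute_diff: "substitute g (f - h) = substitute g f - substitute g h"
  using substitute_add[of g f "- h"] by (simp add: substitute_uminus)

lemma substitute_scalar [simp]: "substitute g (scalar c) = scalar c"
  by (simp add: substitute_single zero_word_def[THEN arg_cong[of _ _ letters]])

lemma substitute_one [simp]: "substitute g 1 = 1"
  using substitute_scalar[of g 1] by simp

lemma substitute_letter [simp]: "substitute g (letter i) = g i"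
  by (simp add: substitute_single)

lemma substitute_prod_list: "substitute g (prod_list l) = prod_list (map (substitute g) l)"
  by (induction l) (simp_all add: substitute_mult)

lemma substitute_boundary: "substitute g (boundary l) = boundary (map (substitute g) l)"
  by (induction l) (simp_all add: substitute_mult substitute_diff substitute_prod_list)

lemma substitute_id_on:
  assumes "f \<in> tensor_carrier E" "\<And>i. i \<in> E \<Longrightarrow> g i = letter i"
  shows "substitute g f = f"
proof -
  have "substitute g f = (\<Sum>w\<in>Poly_Mapping.keys f. Poly_Mapping.single w (Poly_Mapping.lookup f w))"
    unfolding substitute_def
  proof (rule sum.cong)
    fix w assume "w \<in> Poly_Mapping.keys f"
    then have eq: "map g (letters w) = map letter (letters w)"
      using assms by (auto simp: tensor_carrier_def)
    show "scalar (Poly_Mapping.lookup f w) * prod_list (map g (letters w)) =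
        Poly_Mapping.single w (Poly_Mapping.lookup f w)"
      unfolding eq prod_list_letter by (simp add: mult_single)
  qed simp
  then show ?thesis using sum_monomials[of f] by simp
qed

lemma substitute_substitute:
  "substitute g (substitute h f) = substitute (\<lambda>i. substitute g (h i)) f"
  by (simp add: substitute_def[of h] substitute_def[of "\<lambda>i. substitute g (h i)"] substitute_sum
      substitute_mult substitute_prod_list comp_def)

lemma substitute_homog:
  assumes "f \<in> homog (tensor_algebra E) n" "\<And>i. i \<in> E \<Longrightarrow> g i \<in> homog (tensor_algebra E') 1"
  shows "substitute g f \<in> homog (tensor_algebra E') n"
  unfolding substitute_def
proof (rule homog_tensor_sum)
  fix w assume "w \<in> Poly_Mapping.keys f"
  then have w: "set (letters w) \<subseteq> E" "length (letters w) = n"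
    using assms(1) by (auto simp: homog_tensor_iff)
  then have "set (map g (letters w)) \<subseteq> homog (tensor_algebra E') 1" using assms(2) by auto
  from homog_tensor_mult[OF homog_tensor_scalar homog_tensor_prod_list[OF this]] w(2)
  show "scalar (Poly_Mapping.lookup f w) * prod_list (map g (letters w)) \<in> homog (tensor_algebra E') n"
    by simp
qed

lemma substitute_tensor_carrier:
  assumes "f \<in> tensor_carrier E" "\<And>i. i \<in> E \<Longrightarrow> g i \<in> tensor_carrier E'"
  shows "substitute g f \<in> tensor_carrier E'"
  unfolding substitute_def
proof (intro sum_tensor_carrier mult_tensor_carrier scalar_tensor_carrier prod_list_tensor_carrier)
  fix w assume "w \<in> Poly_Mapping.keys f"
  then have "set (letters w) \<subseteq> E" using assms(1) by (simp add: tensor_carrier_def)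
  then show "set (map g (letters w)) \<subseteq> tensor_carrier E'" using assms(2) by auto
qed

lemma substitute_ring_hom:
  assumes "\<And>i. i \<in> E \<Longrightarrow> g i \<in> tensor_carrier E'"
  shows "ring_hom_ring (tensor_algebra E) (tensor_algebra E') (substitute g)"
  using assms by (intro ring_hom_ringI ring_tensor_algebra)
    (auto simp: substitute_mult substitute_add intro: substitute_tensor_carrier)

section \<open>Orlik-Solomon algebras as quotients of tensor algebras\<close>

lemma coset_hom_quotient_algebra:
  assumes "ideal I A"
  shows "(\<lambda>x. I +>\<^bsub>A\<^esub> x) \<in> ring_hom A (quotient_algebra A I)"
  using ideal.rcos_ring_hom[OF assms] by (simp add: ring_hom_def quotient_algebra_def)

lemma carrier_quotient_algebra:
  "carrier (quotient_algebra A I) = (\<lambda>x. I +>\<^bsub>A\<^esub> x) ` carrier A"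
  by (auto simp: quotient_algebra_def FactRing_def A_RCOSETS_def')

lemma zero_quotient_algebra: "zero (quotient_algebra A I) = I"
  by (simp add: quotient_algebra_def FactRing_def)

text \<open>Serves to push ideals of the tensor algebra forward to the exterior algebra.
  Surjectivity lets the image absorb multiplication by arbitrary elements.\<close>

lemma (in ring_hom_ring) ideal_image_surj:
  assumes "ideal J R" "carrier S = h ` carrier R"
  shows "ideal (h ` J) S"
proof -
  interpret J: ideal J R by (rule assms(1))
  show ?thesis
  proof (rule idealI)
    show "subgroup (h ` J) (add_monoid S)"
      by (rule img_is_add_subgroup[OF J.a_subgroup])
    fix a x assume a: "a \<in> h ` J" and x: "x \<in> carrier S"
    then obtain b y where "b \<in> J" "y \<in> carrier R" "a = h b" "x = h y"
      using assms(2) by blast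
    then show "x \<otimes>\<^bsub>S\<^esub> a \<in> h ` J" "a \<otimes>\<^bsub>S\<^esub> x \<in> h ` J"
      using J.I_l_closed[of b y] J.I_r_closed[of b y] J.Icarr[of b]
      by (auto simp flip: hom_mult)
  qed (rule S.ring_axioms)
qed

section \<open>Classes of tensors in the two quotients\<close>

definition ext_class :: "'a set \<Rightarrow> ('a word \<Rightarrow>\<^sub>0 complex) \<Rightarrow> ('a word \<Rightarrow>\<^sub>0 complex) set" where
  "ext_class E x = square_ideal E +>\<^bsub>tensor_algebra E\<^esub> x"

text \<open>The composite of the two quotient maps: every element of the Orlik-Solomon algebra is
  represented by a tensor, which avoids computing with cosets of cosets.\<close>

definition os_class ::
  "'a circuit_system \<Rightarrow> ('a word \<Rightarrow>\<^sub>0 complex) \<Rightarrow> ('a word \<Rightarrow>\<^sub>0 complex) set set" where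
  "os_class H x =
     orlik_solomon_ideal H +>\<^bsub>exterior_algebra (ground H)\<^esub> ext_class (ground H) x"

lemma ext_class_ring_hom: "ring_hom_ring (tensor_algebra E) (exterior_algebra E) (ext_class E)"
  using coset_hom_quotient_algebra[OF ideal_square_ideal[of E]]
  by (intro ring_hom_ringI2 ring_tensor_algebra ring_exterior_algebra)
    (simp add: ext_class_def[abs_def] exterior_algebra_def)

lemma os_class_ring_hom:
  "ring_hom_ring (tensor_algebra (ground H)) (orlik_solomon H) (os_class H)"
proof (intro ring_hom_ringI2 ring_tensor_algebra ring_orlik_solomon)
  have "(\<lambda>x. orlik_solomon_ideal H +>\<^bsub>exterior_algebra (ground H)\<^esub> x)
      \<in> ring_hom (exterior_algebra (ground H)) (orlik_solomon H)"
    unfolding orlik_solomon_def by (intro coset_hom_quotient_algebra ideal_orlik_solomon_ideal)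
  from ring_hom_trans[OF ring_hom_ring.homh[OF ext_class_ring_hom] this]
  show "os_class H \<in> ring_hom (tensor_algebra (ground H)) (orlik_solomon H)"
    by (simp add: comp_def os_class_def[abs_def])
qed

lemma carrier_exterior_algebra: "carrier (exterior_algebra E) = ext_class E ` tensor_carrier E"
  by (simp add: exterior_algebra_def carrier_quotient_algebra ext_class_def)

lemma carrier_orlik_solomon: "carrier (orlik_solomon H) = os_class H ` tensor_carrier (ground H)"
  by (simp add: orlik_solomon_def carrier_quotient_algebra carrier_exterior_algebra image_image
      os_class_def)

lemma homog_orlik_solomon:
  "homog (orlik_solomon H) n = os_class H ` homog (tensor_algebra (ground H)) n"
  by (simp add: orlik_solomon_def exterior_algebra_def quotient_algebra_def image_image
      os_class_def ext_class_def)

lemma ext_class_smult: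
  assumes "x \<in> tensor_carrier E"
  shows "ext_class E (scalar c * x) = c \<odot>\<^bsub>exterior_algebra E\<^esub> ext_class E x"
  using smult_exterior_algebra[of x E c] assms by (simp add: ext_class_def smult_tensor_algebra)

lemma os_class_smult:
  assumes "x \<in> tensor_carrier (ground H)"
  shows "os_class H (scalar c * x) = c \<odot>\<^bsub>orlik_solomon H\<^esub> os_class H x"
proof -
  let ?E = "ground H" and ?X = "exterior_algebra (ground H)"
  interpret h: ring_hom_ring "tensor_algebra ?E" ?X "ext_class ?E" by (rule ext_class_ring_hom)
  \<comment> \<open>\<open>smult_quotient_algebra\<close> expects scaling to be multiplication by
    the scaled unit; in the exterior algebra that element is the class of
    \<open>scalar c\<close>.\<close>
  have smult: "c \<odot>\<^bsub>?X\<^esub> y = ext_class ?E (scalar c) \<otimes>\<^bsub>?X\<^esub> y" if "y \<in> carrier ?X" for y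
    using that h.hom_mult[of "scalar c"]
    by (auto simp: carrier_exterior_algebra scalar_tensor_carrier simp flip: ext_class_smult)
  have sc: "ext_class ?E (scalar c) \<in> carrier ?X"
    using h.hom_closed[of "scalar c"] by (simp add: scalar_tensor_carrier)
  have "c \<odot>\<^bsub>orlik_solomon H\<^esub> os_class H x =
      orlik_solomon_ideal H +>\<^bsub>?X\<^esub> (c \<odot>\<^bsub>?X\<^esub> ext_class ?E x)"
    unfolding orlik_solomon_def os_class_def
    using assms sc h.hom_closed[of x]
    by (intro smult_quotient_algebra ideal_orlik_solomon_ideal)
      (simp_all add: smult h.S.r_distr)
  then show ?thesis
    using assms by (simp add: os_class_def ext_class_smult)
qed

lemma ext_class_prod_letters: "set S \<subseteq> E \<Longrightarrow> ext_class E (prod_list (map letter S)) = ext_monomial E S"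
proof (induction S)
  case Nil
  interpret h: ring_hom_ring "tensor_algebra E" "exterior_algebra E" "ext_class E"
    by (rule ext_class_ring_hom)
  show ?case using h.hom_one by (simp add: ext_monomial_def)
next
  case (Cons i S)
  interpret h: ring_hom_ring "tensor_algebra E" "exterior_algebra E" "ext_class E"
    by (rule ext_class_ring_hom)
  have "letter i \<in> tensor_carrier E" "set (map letter S) \<subseteq> tensor_carrier E"
    using Cons.prems by (auto intro!: homog_tensor_carrier[OF homog_tensor_letter])
  then have "ext_class E (letter i * prod_list (map letter S)) =
      ext_class E (letter i) \<otimes>\<^bsub>exterior_algebra E\<^esub> ext_class E (prod_list (map letter S))"
    using h.hom_mult[of "letter i" "prod_list (map letter S)"]
    by (simp add: prod_list_tensor_carrier)
  then show ?case
    using Cons by (simp add: ext_monomial_def ext_gen_def ext_class_def)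
qed

lemma ext_class_sum:
  assumes "finite X" "\<And>x. x \<in> X \<Longrightarrow> f x \<in> tensor_carrier E"
  shows "ext_class E (\<Sum>x\<in>X. f x) = (\<Oplus>\<^bsub>exterior_algebra E\<^esub>x\<in>X. ext_class E (f x))"
proof -
  interpret h: ring_hom_ring "tensor_algebra E" "exterior_algebra E" "ext_class E"
    by (rule ext_class_ring_hom)
  show ?thesis
    using assms
  proof (induction X)
    case empty
    then show ?case using h.hom_zero by simp
  next
    case (insert x X)
    then have "ext_class E (f x + sum f X) =
        ext_class E (f x) \<oplus>\<^bsub>exterior_algebra E\<^esub> ext_class E (sum f X)"
      using h.hom_add[of "f x" "sum f X"] by (simp add: sum_tensor_carrier)
    moreover have "ext_class E (f y) \<in> carrier (exterior_algebra E)" if "y \<in> insert x X" for y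
      using insert.prems[OF that] h.hom_closed[of "f y"] by simp
    ultimately show ?case
      using insert by (simp add: h.S.finsum_insert Pi_def)
  qed
qed

lemma ext_class_boundary:
  assumes "set S \<subseteq> E"
  shows "ext_class E (boundary (map letter S)) = boundary_monomial E S"
proof -
  interpret h: ring_hom_ring "tensor_algebra E" "exterior_algebra E" "ext_class E"
    by (rule ext_class_ring_hom)
  define m where "m k = prod_list (map letter (take k S @ drop (Suc k) S))" for k
  have sub: "set (take k S @ drop (Suc k) S) \<subseteq> E" for k
    using assms set_take_subset[of k S] set_drop_subset[of "Suc k" S] by auto
  have m: "m k \<in> tensor_carrier E" for k
    using sub[of k] unfolding m_def
    by (intro prod_list_tensor_carrier)
      (auto intro!: homog_tensor_carrier[OF homog_tensor_letter])
  have em: "ext_class E (m k) = ext_monomial E (take k S @ drop (Suc k) S)" for k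
    unfolding m_def by (rule ext_class_prod_letters[OF sub])
  \<comment> \<open>In \<open>boundary_sum\<close> the signs are ring elements, in
    \<open>boundary_monomial\<close> complex scalars; as multiples of the empty word they
    agree.\<close>
  have sgn: "(- 1) ^ k * x = scalar ((- 1) ^ k) * x" for k :: nat and x :: "'a word \<Rightarrow>\<^sub>0 complex"
    by (cases "even k") (simp_all add: single_uminus)
  have "boundary (map letter S) = (\<Sum>k<length S. scalar ((- 1) ^ k) * m k)"
    unfolding boundary_sum m_def length_map
    by (intro sum.cong refl) (simp only: sgn take_map drop_map map_append)
  also have "ext_class E \<dots> =
      (\<Oplus>\<^bsub>exterior_algebra E\<^esub>k\<in>{..<length S}. ext_class E (scalar ((- 1) ^ k) * m k))"
    using m by (intro ext_class_sum) (auto intro: mult_tensor_carrier scalar_tensor_carrier)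
  also have "\<dots> = boundary_monomial E S"
    unfolding boundary_monomial_def
    by (intro h.S.finsum_cong') (simp_all add: Pi_def ext_class_smult[OF m] em
        smult_exterior_algebra_closed[OF ext_monomial_closed[OF sub]])
  finally show ?thesis .
qed

section \<open>The kernel of the map from the tensor algebra to the Orlik-Solomon algebra\<close>

definition os_kernel :: "'a circuit_system \<Rightarrow> ('a word \<Rightarrow>\<^sub>0 complex) set" where
  "os_kernel H = a_kernel (tensor_algebra (ground H)) (orlik_solomon H) (os_class H)"

lemma ideal_os_kernel: "ideal (os_kernel H) (tensor_algebra (ground H))"
  unfolding os_kernel_def by (intro ring_hom_ring.kernel_is_ideal os_class_ring_hom)

lemma os_kernel_iff:
  "x \<in> os_kernel H \<longleftrightarrow>
     x \<in> tensor_carrier (ground H) \<and> ext_class (ground H) x \<in> orlik_solomon_ideal H"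
proof -
  let ?E = "ground H" and ?X = "exterior_algebra (ground H)"
  interpret h: ring_hom_ring "tensor_algebra ?E" ?X "ext_class ?E" by (rule ext_class_ring_hom)
  interpret I: ideal "orlik_solomon_ideal H" ?X by (rule ideal_orlik_solomon_ideal)
  have zero: "zero (orlik_solomon H) = orlik_solomon_ideal H"
    by (simp add: orlik_solomon_def zero_quotient_algebra)
  have "os_class H x = orlik_solomon_ideal H \<longleftrightarrow> ext_class ?E x \<in> orlik_solomon_ideal H"
    if "x \<in> tensor_carrier ?E"
  proof -
    have "ext_class ?E x \<in> carrier ?X" using h.hom_closed[of x] that by simp
    then show ?thesis unfolding os_class_def
      by (metis I.a_rcos_const ideal.rcos_const_imp_mem[OF ideal_orlik_solomon_ideal])
  qed
  then show ?thesis
    unfolding os_kernel_def a_kernel_def' tensor_algebra_simps zero by blast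
qed

lemma os_class_eq_iff:
  assumes "x \<in> tensor_carrier (ground H)" "y \<in> tensor_carrier (ground H)"
  shows "os_class H x = os_class H y \<longleftrightarrow> x - y \<in> os_kernel H"
proof -
  let ?T = "tensor_algebra (ground H)"
  interpret h: ring_hom_ring ?T "orlik_solomon H" "os_class H" by (rule os_class_ring_hom)
  have car: "os_class H x \<in> carrier (orlik_solomon H)" "os_class H y \<in> carrier (orlik_solomon H)"
    using assms h.hom_closed[of x] h.hom_closed[of y] by simp_all
  have "os_class H (- y) = \<ominus>\<^bsub>orlik_solomon H\<^esub> os_class H y"
    using h.hom_a_inv[of y] assms(2) by (simp only: tensor_algebra_simps a_inv_tensor_algebra)
  then have "os_class H (x + - y) = os_class H x \<ominus>\<^bsub>orlik_solomon H\<^esub> os_class H y"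
    using h.hom_add[of x "- y"] assms
    by (simp only: tensor_algebra_simps uminus_tensor_carrier a_minus_def)
  then have "x - y \<in> os_kernel H \<longleftrightarrow>
      os_class H x \<ominus>\<^bsub>orlik_solomon H\<^esub> os_class H y = zero (orlik_solomon H)"
    using assms by (simp only: os_kernel_def a_kernel_def' diff_tensor_carrier mem_Collect_eq
        tensor_algebra_simps add_uminus_conv_diff simp_thms)
  then show ?thesis
    using car by (metis a_minus_def h.S.a_inv_closed h.S.minus_equality h.S.minus_minus h.S.r_neg)
qed

lemma square_zero_ideal_os_kernel:
  "square_zero_ideal (tensor_carrier (ground H)) (homog (tensor_algebra (ground H)) 1) (os_kernel H)"
proof -
  let ?T = "tensor_algebra (ground H)"
  interpret h: ring_hom_ring ?T "exterior_algebra (ground H)" "ext_class (ground H)"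
    by (rule ext_class_ring_hom)
  interpret K: ideal "os_kernel H" ?T by (rule ideal_os_kernel)
  show ?thesis
  proof
    show "x * y \<in> os_kernel H" if "x \<in> tensor_carrier (ground H)" "y \<in> os_kernel H" for x y
      using K.I_l_closed[of y x] that by simp
    show "x * y \<in> os_kernel H" if "x \<in> os_kernel H" "y \<in> tensor_carrier (ground H)" for x y
      using K.I_r_closed[of x y] that by simp
    show "- x \<in> os_kernel H" if "x \<in> os_kernel H" for x
      using K.I_l_closed[of x "- 1"] that by (simp add: uminus_tensor_carrier one_tensor_carrier)
    show "x + y \<in> os_kernel H" if "x \<in> os_kernel H" "y \<in> os_kernel H" for x y
      using K.a_closed[of x y] that by simp
    show "0 \<in> os_kernel H" using K.zero_closed by simp
    show "v * v \<in> os_kernel H" if v: "v \<in> homog ?T 1" for v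
    proof -
      interpret S: ideal "square_ideal (ground H)" ?T by (rule ideal_square_ideal)
      have vv: "v * v \<in> tensor_carrier (ground H)"
        using v by (intro mult_tensor_carrier homog_tensor_carrier)
      have "{v * v |v. v \<in> homog ?T 1} \<subseteq> carrier ?T"
        by (auto intro!: mult_tensor_carrier dest!: homog_tensor_carrier)
      from h.R.genideal_self[OF this] have "v * v \<in> square_ideal (ground H)"
        unfolding square_ideal_def using v by blast
      then have "ext_class (ground H) (v * v) = zero (exterior_algebra (ground H))"
        by (simp add: ext_class_def S.a_rcos_const exterior_algebra_def zero_quotient_algebra)
      then show ?thesis
        using vv ideal.axioms(1)[OF ideal_orlik_solomon_ideal[of H]]
        by (simp add: os_kernel_iff additive_subgroup.zero_closed)
    qed
  qed (auto intro: one_tensor_carrier add_tensor_carrier uminus_tensor_carrier mult_tensor_carrier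
      homog_tensor_carrier homog_tensor_add)
qed

lemma boundary_in_os_kernel:
  assumes "distinct S" "dependent H (set S)"
  shows "boundary (map letter S) \<in> os_kernel H"
proof -
  interpret h: ring_hom_ring "tensor_algebra (ground H)" "exterior_algebra (ground H)"
    "ext_class (ground H)" by (rule ext_class_ring_hom)
  interpret K: square_zero_ideal "tensor_carrier (ground H)" "homog (tensor_algebra (ground H)) 1"
    "os_kernel H" by (rule square_zero_ideal_os_kernel)
  have S: "set S \<subseteq> ground H" using assms(2) by (simp add: dependent_def)
  have "boundary_monomial (ground H) S \<in> orlik_solomon_ideal H"
    unfolding orlik_solomon_ideal_def using assms
    by (intro subsetD[OF h.S.genideal_self])
      (auto simp: dependent_def intro!: boundary_monomial_closed)
  moreover have "boundary (map letter S) \<in> tensor_carrier (ground H)"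
    using S by (intro K.boundary_R) (auto simp: homog_tensor_iff)
  ultimately show ?thesis
    using S by (simp add: os_kernel_iff ext_class_boundary)
qed

text \<open>With \<open>square_zero_ideal_os_kernel\<close> and
  \<open>boundary_in_os_kernel\<close>, this makes the kernel the ideal generated by squares and
  boundaries together. The image of \<open>J\<close> in the exterior algebra is an ideal containing
  the Orlik-Solomon ideal; lifting back costs an error in the square ideal, which lies in
  \<open>J\<close>.\<close>

lemma os_kernel_minimal:
  assumes J: "ideal J (tensor_algebra (ground H))"
    and square: "\<And>v. v \<in> homog (tensor_algebra (ground H)) 1 \<Longrightarrow> v * v \<in> J"
    and boundary: "\<And>S. distinct S \<Longrightarrow> dependent H (set S) \<Longrightarrow> boundary (map letter S) \<in> J"
  shows "os_kernel H \<subseteq> J"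
proof
  fix x assume x: "x \<in> os_kernel H"
  let ?E = "ground H" and ?T = "tensor_algebra (ground H)" and ?X = "exterior_algebra (ground H)"
  interpret h: ring_hom_ring ?T ?X "ext_class ?E" by (rule ext_class_ring_hom)
  interpret J: ideal J ?T by (rule J)
  interpret S: ideal "square_ideal ?E" ?T by (rule ideal_square_ideal)
  have SJ: "square_ideal ?E \<subseteq> J"
    unfolding square_ideal_def using square by (intro h.R.genideal_minimal J) blast
  have "ideal (ext_class ?E ` J) ?X"
    by (rule h.ideal_image_surj[OF J]) (simp add: carrier_exterior_algebra)
  moreover have "boundary_monomial ?E S \<in> ext_class ?E ` J"
    if "distinct S" "dependent H (set S)" for S
    using boundary[OF that] that(2) ext_class_boundary[of S ?E] unfolding dependent_def
    by (metis imageI)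
  ultimately have "orlik_solomon_ideal H \<subseteq> ext_class ?E ` J"
    unfolding orlik_solomon_ideal_def by (intro h.S.genideal_minimal) auto
  then obtain y where y: "y \<in> J" "ext_class ?E x = ext_class ?E y"
    using x by (auto simp: os_kernel_iff)
  have car: "x \<in> tensor_carrier ?E" "y \<in> tensor_carrier ?E"
    using x y(1) J.Icarr[of y] by (auto simp: os_kernel_iff)
  then have "x \<ominus>\<^bsub>?T\<^esub> y \<in> square_ideal ?E"
    using y(2) h.R.quotient_eq_iff_same_a_r_cos[OF ideal_square_ideal, of x y]
    by (simp add: ext_class_def)
  then have "x - y \<in> J" using SJ car by (auto simp: a_minus_tensor_algebra)
  then have "(x - y) + y \<in> J" using J.a_closed[of "x - y" y] y(1) by simp
  then show "x \<in> J" by simp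
qed

text \<open>The preimage of \<open>os_kernel H'\<close> under \<open>substitute g\<close> is an
  ideal. It contains the squares because \<open>g\<close> sends letters to vectors, so by minimality
  only the boundaries remain, and those are \<open>rel\<close>.\<close>

lemma substitute_os_kernel:
  assumes g: "\<And>i. i \<in> ground H \<Longrightarrow> g i \<in> homog (tensor_algebra (ground H')) 1"
    and rel: "\<And>S. distinct S \<Longrightarrow> dependent H (set S) \<Longrightarrow> boundary (map g S) \<in> os_kernel H'"
    and x: "x \<in> os_kernel H"
  shows "substitute g x \<in> os_kernel H'"
proof -
  let ?T = "tensor_algebra (ground H)" and ?T' = "tensor_algebra (ground H')"
  let ?J = "{x \<in> carrier ?T. substitute g x \<in> os_kernel H'}"
  interpret s: ring_hom_ring ?T ?T' "substitute g"
    using g by (intro substitute_ring_hom) (rule homog_tensor_carrier)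
  interpret K: square_zero_ideal "tensor_carrier (ground H')" "homog ?T' 1" "os_kernel H'"
    by (rule square_zero_ideal_os_kernel)
  interpret L: square_zero_ideal "tensor_carrier (ground H)" "homog ?T 1" "os_kernel H"
    by (rule square_zero_ideal_os_kernel)
  have "os_kernel H \<subseteq> ?J"
  proof (rule os_kernel_minimal)
    show "ideal ?J ?T" by (rule s.ideal_vimage[OF ideal_os_kernel])
  next
    fix v assume v: "v \<in> homog ?T 1"
    have "substitute g v \<in> homog ?T' 1" by (rule substitute_homog[OF v g])
    from K.square_K[OF this] show "v * v \<in> ?J"
      using L.mult_R[OF L.V_R[OF v] L.V_R[OF v]] by (simp add: substitute_mult)
  next
    fix S :: "'a list" assume S: "distinct S" "dependent H (set S)"
    then have "set (map letter S) \<subseteq> homog ?T 1"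
      by (auto simp: dependent_def homog_tensor_iff)
    from L.boundary_R[OF this] rel[OF S] show "boundary (map letter S) \<in> ?J"
      by (simp add: substitute_boundary comp_def)
  qed
  then show ?thesis using x by blast
qed

text \<open>Substitutions that are mutually inverse already on tensors and respect the relations
  both ways descend to an isomorphism. Degrees are kept because letters go to vectors.\<close>

lemma orlik_solomon_isomorphicI:
  fixes H H' :: "'a circuit_system"
  assumes g: "\<And>i. i \<in> ground H \<Longrightarrow> g i \<in> homog (tensor_algebra (ground H')) 1"
    and g': "\<And>i. i \<in> ground H' \<Longrightarrow> g' i \<in> homog (tensor_algebra (ground H)) 1"
    and rel: "\<And>S. distinct S \<Longrightarrow> dependent H (set S) \<Longrightarrow> boundary (map g S) \<in> os_kernel H'"
    and rel': "\<And>S. distinct S \<Longrightarrow> dependent H' (set S) \<Longrightarrow> boundary (map g' S) \<in> os_kernel H"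
    and inverse: "\<And>i. i \<in> ground H \<Longrightarrow> substitute g' (g i) = letter i"
    and inverse': "\<And>i. i \<in> ground H' \<Longrightarrow> substitute g (g' i) = letter i"
  shows "orlik_solomon H \<cong>\<^sub>g\<^sub>r orlik_solomon H'"
proof -
  let ?A = "orlik_solomon H" and ?B = "orlik_solomon H'"
  let ?T = "tensor_carrier (ground H)" and ?T' = "tensor_carrier (ground H')"
  interpret a: ring_hom_ring "tensor_algebra (ground H)" ?A "os_class H" by (rule os_class_ring_hom)
  interpret b: ring_hom_ring "tensor_algebra (ground H')" ?B "os_class H'" by (rule os_class_ring_hom)
  have closed: "substitute g x \<in> ?T'" if "x \<in> ?T" for x
    using that homog_tensor_carrier[OF g] by (rule substitute_tensor_carrier)
  have closed': "substitute g' y \<in> ?T" if "y \<in> ?T'" for y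
    using that homog_tensor_carrier[OF g'] by (rule substitute_tensor_carrier)
  have sub_back: "substitute g' (substitute g x) = x" if "x \<in> ?T" for x
    unfolding substitute_substitute using that inverse by (rule substitute_id_on)
  have sub_back': "substitute g (substitute g' y) = y" if "y \<in> ?T'" for y
    unfolding substitute_substitute using that inverse' by (rule substitute_id_on)
  \<comment> \<open>The implication from left to right applies \<open>g'\<close>, which undoes
    \<open>g\<close>.\<close>
  have ker: "substitute g x \<in> os_kernel H' \<longleftrightarrow> x \<in> os_kernel H" if "x \<in> ?T" for x
    using substitute_os_kernel[of H g H' x, OF g rel]
      substitute_os_kernel[of H' g' H "substitute g x", OF g' rel'] sub_back[OF that] by metis
  have eq: "os_class H' (substitute g x) = os_class H' (substitute g y) \<longleftrightarrow> os_class H x = os_class H y"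
    if "x \<in> ?T" "y \<in> ?T" for x y
    using os_class_eq_iff[OF that] os_class_eq_iff[OF closed[OF that(1)] closed[OF that(2)]]
      ker[OF diff_tensor_carrier[OF that]] by (simp add: substitute_diff)
  \<comment> \<open>\<open>h\<close> acts on a chosen representative. One half of \<open>eq\<close>
    makes the choice immaterial, the other gives injectivity.\<close>
  define h where "h X = os_class H' (substitute g (SOME x. x \<in> ?T \<and> os_class H x = X))" for X
  have h: "h (os_class H x) = os_class H' (substitute g x)" if "x \<in> ?T" for x
  proof -
    let ?y = "SOME y. y \<in> ?T \<and> os_class H y = os_class H x"
    have "?y \<in> ?T \<and> os_class H ?y = os_class H x" using that by (intro someI) blast
    then show ?thesis unfolding h_def using eq that by blast
  qed
  have homog: "h ` homog ?A n = homog ?B n" for n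
  proof -
    have "h ` homog ?A n = (\<lambda>x. os_class H' (substitute g x)) ` homog (tensor_algebra (ground H)) n"
      unfolding homog_orlik_solomon image_image
      by (intro image_cong refl h) (rule homog_tensor_carrier)
    also have "\<dots> = os_class H' ` homog (tensor_algebra (ground H')) n"
    proof (intro equalityI image_subsetI)
      fix x assume "x \<in> homog (tensor_algebra (ground H)) n"
      from substitute_homog[OF this g]
      show "os_class H' (substitute g x) \<in> os_class H' ` homog (tensor_algebra (ground H')) n"
        by (rule imageI)
    next
      fix y assume y: "y \<in> homog (tensor_algebra (ground H')) n"
      show "os_class H' y \<in> (\<lambda>x. os_class H' (substitute g x)) ` homog (tensor_algebra (ground H)) n"
        by (rule image_eqI[OF _ substitute_homog[OF y g']])
          (simp_all add: sub_back' homog_tensor_carrier[OF y])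
    qed
    finally show ?thesis by (simp only: homog_orlik_solomon)
  qed
  have "bij_betw h (carrier ?A) (carrier ?B)"
  proof (rule bij_betw_imageI)
    show "inj_on h (carrier ?A)"
      using eq h by (auto simp: inj_on_def carrier_orlik_solomon)
    have "h ` carrier ?A = os_class H' ` substitute g ` ?T"
      unfolding carrier_orlik_solomon image_image by (intro image_cong refl h)
    moreover have "substitute g ` ?T = ?T'"
      using closed closed' sub_back' by (metis (no_types, lifting) image_eqI image_subsetI subsetI subset_antisym)
    ultimately show "h ` carrier ?A = carrier ?B" by (simp only: carrier_orlik_solomon)
  qed
  moreover have "h \<in> ring_hom ?A ?B"
  proof (rule ring_hom_memI)
    fix X assume "X \<in> carrier ?A"
    then obtain x where x: "x \<in> ?T" "X = os_class H x" by (auto simp: carrier_orlik_solomon)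
    show "h X \<in> carrier ?B"
      unfolding x(2) h[OF x(1)] carrier_orlik_solomon using closed[OF x(1)] by (rule imageI)
    fix Y assume "Y \<in> carrier ?A"
    then obtain y where y: "y \<in> ?T" "Y = os_class H y" by (auto simp: carrier_orlik_solomon)
    show "h (X \<otimes>\<^bsub>?A\<^esub> Y) = h X \<otimes>\<^bsub>?B\<^esub> h Y"
      using x y a.hom_mult[of x y] h[of "x * y"] mult_tensor_carrier[OF x(1) y(1)]
        b.hom_mult[of "substitute g x" "substitute g y"]
      by (simp add: h closed substitute_mult)
    show "h (X \<oplus>\<^bsub>?A\<^esub> Y) = h X \<oplus>\<^bsub>?B\<^esub> h Y"
      using x y a.hom_add[of x y] h[of "x + y"] add_tensor_carrier[OF x(1) y(1)]
        b.hom_add[of "substitute g x" "substitute g y"]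
      by (simp add: h closed substitute_add)
  next
    show "h \<one>\<^bsub>?A\<^esub> = \<one>\<^bsub>?B\<^esub>"
      using a.hom_one b.hom_one h[OF one_tensor_carrier] by simp
  qed
  moreover have "h (c \<odot>\<^bsub>?A\<^esub> X) = c \<odot>\<^bsub>?B\<^esub> h X" if X: "X \<in> carrier ?A" for c X
  proof -
    obtain x where x: "x \<in> ?T" "X = os_class H x"
      using X by (auto simp: carrier_orlik_solomon)
    show ?thesis
      using h[OF mult_tensor_carrier[OF scalar_tensor_carrier[of c] x(1)]]
      unfolding x(2) h[OF x(1)] os_class_smult[OF x(1)] substitute_mult substitute_scalar
        os_class_smult[OF closed[OF x(1)]] .
  qed
  ultimately have "h \<in> graded_algebra_iso ?A ?B"
    by (simp add: graded_algebra_iso_def ring_iso_def homog)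
  then show ?thesis unfolding graded_algebra_isomorphic_def by blast
qed

text \<open>Reduces the relations of all dependent sets, in all orders, to a single enumeration of
  each circuit.\<close>

lemma (in square_zero_ideal) boundary_dependent_K:
  assumes "\<And>i. i \<in> ground H \<Longrightarrow> g i \<in> V"
    and circuit: "\<And>C. C \<in> circuits H \<Longrightarrow> \<exists>xs. distinct xs \<and> set xs = C \<and> null_list (map g xs)"
    and S: "distinct S" "dependent H (set S)"
  shows "boundary (map g S) \<in> K"
proof -
  obtain C where "C \<in> circuits H" "C \<subseteq> set S" and gr: "set S \<subseteq> ground H"
    using S(2) by (auto simp: dependent_def)
  moreover obtain xs where "distinct xs" "set xs = C" "null_list (map g xs)"
    using circuit[OF calculation(1)] by blast
  ultimately have "null_list (map g S)"
    using S(1) assms(1) by (intro null_list_filter[of g xs S]) auto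
  then show ?thesis by (simp add: null_list_def)
qed

abbreviation os_null :: "'a circuit_system \<Rightarrow> ('a word \<Rightarrow>\<^sub>0 complex) list \<Rightarrow> bool" where
  "os_null H \<equiv> square_zero_ideal.null_list (os_kernel H)"

text \<open>A circuit is dependent, so its boundary is a relation; since it is nonempty, its product
  lies in the kernel too.\<close>

lemma os_null_circuit:
  assumes "matroid H" "C \<in> circuits H" "distinct xs" "set xs = C"
  shows "os_null H (map letter xs)"
proof -
  interpret square_zero_ideal "tensor_carrier (ground H)" "homog (tensor_algebra (ground H)) 1"
    "os_kernel H" by (rule square_zero_ideal_os_kernel)
  have C: "C \<subseteq> ground H" "C \<noteq> {}" using assms by (auto simp: matroid_def)
  then have "set (map letter xs) \<subseteq> homog (tensor_algebra (ground H)) 1" "map letter xs \<noteq> []"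
    using assms(4) by (auto simp: homog_tensor_iff)
  moreover have "boundary (map letter xs) \<in> os_kernel H"
    using assms C by (intro boundary_in_os_kernel) (auto simp: dependent_def)
  ultimately show ?thesis by (simp add: null_list_def boundary_K_imp_prod_list_K)
qed

section \<open>Parallel connections and direct sums\<close>

text \<open>Renaming brings in \<open>p\<close> only at \<open>q\<close>, since \<open>p\<close> is
  no other element of \<open>C\<close>. This covers both \<open>p = q\<close> and a new
  label.\<close>

lemma relabel_point:
  assumes "p \<in> (id(q := p)) ` C" "p \<notin> C - {q}"
  shows "q \<in> C" "(id(q := p)) ` C - {p} = C - {q}"
proof -
  show q: "q \<in> C"
  proof (rule ccontr)
    assume "q \<notin> C"
    then have "(id(q := p)) ` C = C" by force
    then show False using assms \<open>q \<notin> C\<close> by blast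
  qed
  have "(id(q := p)) ` C = insert p (C - {q})"
    using q by (simp only: fun_upd_image if_True image_id id_apply)
  then show "(id(q := p)) ` C - {p} = C - {q}" using assms(2) by blast
qed

section \<open>The two matroids and their circuits\<close>

locale parallel_gluing =
  fixes G0 G1 :: "'a circuit_system" and p0 p1 p z :: 'a
  assumes simple: "simple_matroid G0" "simple_matroid G1"
    and disjoint: "ground G0 \<inter> ground G1 = {}"
    and points: "p0 \<in> ground G0" "p1 \<in> ground G1"
    and p_fresh: "p \<notin> (ground G0 - {p0}) \<union> (ground G1 - {p1})"
    and z_fresh: "z \<notin> ground (parallel_connection G0 p0 G1 p1 p)"
begin

abbreviation "r0 \<equiv> id(p0 := p)"
abbreviation "r1 \<equiv> id(p1 := p)"

definition separate where "separate = direct_sum G0 G1"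
definition glued where "glued = direct_sum (isthmus z) (parallel_connection G0 p0 G1 p1 p)"

lemma ground_separate: "ground separate = ground G0 \<union> ground G1"
  and circuits_separate: "circuits separate = circuits G0 \<union> circuits G1"
  by (simp_all add: separate_def direct_sum_def)

lemma ground_glued: "ground glued = insert z (r0 ` ground G0 \<union> r1 ` ground G1)"
  and circuits_glued: "circuits glued = image r0 ` circuits G0 \<union> image r1 ` circuits G1 \<union>
    {(r0 ` C - {p}) \<union> (r1 ` D - {p}) | C D.
      C \<in> circuits G0 \<and> D \<in> circuits G1 \<and> p \<in> r0 ` C \<and> p \<in> r1 ` D}"
  unfolding glued_def direct_sum_def isthmus_def parallel_connection_def glue_at_def relabel_def
    circuit_system.simps by blast+

lemma z_notin: "z \<notin> r0 ` ground G0" "z \<notin> r1 ` ground G1"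
  using z_fresh by (simp_all add: parallel_connection_def glue_at_def relabel_def)

lemma inj_relabel: "inj_on r0 (ground G0)" "inj_on r1 (ground G1)"
  using p_fresh by (auto simp: inj_on_def)

lemma matroid_separate: "matroid separate"
  unfolding separate_def by (intro simple_imp_matroid simple_matroid_direct_sum simple disjoint)

lemma matroid_glued: "matroid glued"
  unfolding glued_def using z_fresh
  by (intro simple_imp_matroid simple_matroid_direct_sum simple_matroid_isthmus
      simple_matroid_parallel_connection simple disjoint points p_fresh)
    (simp add: isthmus_def)

lemma circuit_subset:
  "C \<in> circuits G0 \<Longrightarrow> C \<subseteq> ground G0" "C \<in> circuits G1 \<Longrightarrow> C \<subseteq> ground G1"
  using simple by (auto simp: simple_matroid_def matroid_def)

section \<open>The two mutually inverse substitutions\<close>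

definition split_map :: "'a \<Rightarrow> 'a word \<Rightarrow>\<^sub>0 complex" where
  "split_map i = (if i \<in> ground G0 then letter (r0 i) else letter (r1 i) + (letter z - letter p))"

text \<open>The test for \<open>z\<close> comes first because \<open>z\<close> may be \<open>p0\<close> or \<open>p1\<close> when \<open>p\<close> is a new label.\<close>

definition join_map :: "'a \<Rightarrow> 'a word \<Rightarrow>\<^sub>0 complex" where
  "join_map k =
     (if k = z then letter p1 else if k = p then letter p0 else if k \<in> ground G0 then letter k
      else letter k + (letter p0 - letter p1))"

lemma split_map_left: "i \<in> ground G0 \<Longrightarrow> split_map i = letter (r0 i)"
  by (simp add: split_map_def)

lemma split_map_right: "j \<in> ground G1 \<Longrightarrow> split_map j = letter (r1 j) + (letter z - letter p)"
  using disjoint by (auto simp: split_map_def)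

lemma join_map_left: "i \<in> ground G0 \<Longrightarrow> join_map (r0 i) = letter i"
  using z_notin(1) p_fresh by (auto simp: join_map_def)

text \<open>For \<open>j = p1\<close> the lookup happens at \<open>p\<close> and returns
  \<open>letter p0\<close>, which is the shifted value because the two copies of
  \<open>letter p1\<close> cancel. Hence one formula serves all of \<open>G1\<close>.\<close>

lemma join_map_right: "j \<in> ground G1 \<Longrightarrow> join_map (r1 j) = letter j + (letter p0 - letter p1)"
  using z_notin(2) p_fresh disjoint by (auto simp: join_map_def)

lemma join_map_z: "join_map z = letter p1"
  by (simp add: join_map_def)

lemma p_in_images: "p \<in> r0 ` ground G0" "p \<in> r1 ` ground G1"
  using points by force+

lemma split_map_homog:
  assumes "i \<in> ground separate"
  shows "split_map i \<in> homog (tensor_algebra (ground glued)) 1"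
proof (cases "i \<in> ground G0")
  case True
  then show ?thesis
    unfolding split_map_left[OF True] by (intro homog_tensor_letter) (simp add: ground_glued)
next
  case False
  then have i: "i \<in> ground G1" using assms by (simp add: ground_separate)
  then show ?thesis
    unfolding split_map_right[OF i] using p_in_images
    by (intro homog_tensor_add homog_tensor_diff homog_tensor_letter) (auto simp: ground_glued)
qed

lemma join_map_homog:
  assumes "k \<in> ground glued"
  shows "join_map k \<in> homog (tensor_algebra (ground separate)) 1"
proof -
  have l: "letter i \<in> homog (tensor_algebra (ground separate)) 1" if "i \<in> ground G0 \<union> ground G1" for i
    using that by (intro homog_tensor_letter) (simp add: ground_separate)
  consider "k = z" | i where "i \<in> ground G0" "k = r0 i" | j where "j \<in> ground G1" "k = r1 j"
    using assms by (auto simp: ground_glued)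
  then show ?thesis
  proof cases
    case 1
    then show ?thesis using points l[of p1] by (simp only: join_map_z Un_iff simp_thms)
  next
    case 2
    then show ?thesis using l[of i] by (simp only: join_map_left Un_iff simp_thms)
  next
    case 3
    show ?thesis
      unfolding 3(2) join_map_right[OF 3(1)] using 3(1) points
      by (intro homog_tensor_add homog_tensor_diff l) auto
  qed
qed

lemma join_split:
  assumes "i \<in> ground separate"
  shows "substitute join_map (split_map i) = letter i"
proof (cases "i \<in> ground G0")
  case True
  then show ?thesis
    by (simp only: split_map_left substitute_letter join_map_left)
next
  case False
  then have i: "i \<in> ground G1" using assms by (simp add: ground_separate)
  \<comment> \<open>As \<open>z\<close> goes to \<open>letter p1\<close> and \<open>p\<close> to
    \<open>letter p0\<close>, the shift \<open>letter z - letter p\<close> is sent to the negative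
    of the shift in \<open>join_map\<close>.\<close>
  have "join_map p = letter p0" using join_map_left[OF points(1)] by simp
  then show ?thesis
    by (simp only: split_map_right[OF i] substitute_add substitute_diff substitute_letter
        join_map_right[OF i] join_map_z) simp
qed

lemma split_join:
  assumes "k \<in> ground glued"
  shows "substitute split_map (join_map k) = letter k"
proof -
  \<comment> \<open>These two values send the shift \<open>letter p0 - letter p1\<close> to
    \<open>letter p - letter z\<close>, the negative of the shift in
    \<open>split_map\<close>.\<close>
  have p1: "split_map p1 = letter z" using split_map_right[OF points(2)] by simp
  have p0: "split_map p0 = letter p" using split_map_left[OF points(1)] by simp
  consider "k = z" | i where "i \<in> ground G0" "k = r0 i" | j where "j \<in> ground G1" "k = r1 j"
    using assms by (auto simp: ground_glued)
  then show ?thesis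
  proof cases
    case 1
    then show ?thesis by (simp only: join_map_z substitute_letter p1)
  next
    case 2
    then show ?thesis by (simp only: join_map_left substitute_letter split_map_left)
  next
    case 3
    show ?thesis
      unfolding 3(2) join_map_right[OF 3(1)]
      by (simp only: substitute_add substitute_diff substitute_letter split_map_right[OF 3(1)] p0 p1)
        simp
  qed
qed

section \<open>Transport of the circuit relations\<close>

lemma split_map_relations:
  assumes "distinct S" "dependent separate (set S)"
  shows "boundary (map split_map S) \<in> os_kernel glued"
proof -
  interpret K: square_zero_ideal "tensor_carrier (ground glued)"
    "homog (tensor_algebra (ground glued)) 1" "os_kernel glued"
    by (rule square_zero_ideal_os_kernel)
  show ?thesis
  proof (rule K.boundary_dependent_K[OF split_map_homog _ assms])
    fix C assume C: "C \<in> circuits separate"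
    then have "finite C" using matroid_separate by (meson PowD finite_subset matroid_def subsetD)
    then obtain xs where xs: "set xs = C" "distinct xs" using finite_distinct_list by blast
    have "K.null_list (map split_map xs)"
    proof (cases "C \<in> circuits G0")
      case True
      have sub: "C \<subseteq> ground G0" by (rule circuit_subset(1)[OF True])
      \<comment> \<open>On the \<open>G0\<close> side the substitution merely renames, so the
        circuit goes to a circuit of the parallel connection.\<close>
      have "map split_map xs = map letter (map r0 xs)"
        using sub xs(1) split_map_left by auto
      moreover have "K.null_list (map letter (map r0 xs))"
      proof (rule os_null_circuit[OF matroid_glued, of "r0 ` C"])
        show "r0 ` C \<in> circuits glued" using True by (simp add: circuits_glued)
        show "distinct (map r0 xs)"
          using xs sub inj_relabel(1) by (simp add: distinct_map inj_on_subset)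
      qed (simp add: xs(1))
      ultimately show ?thesis by (simp only:)
    next
      case False
      then have C1: "C \<in> circuits G1" using C by (simp add: circuits_separate)
      have sub: "C \<subseteq> ground G1" by (rule circuit_subset(2)[OF C1])
      \<comment> \<open>On the \<open>G1\<close> side it is a renaming followed by a translation,
        which keeps null lists null.\<close>
      have "map split_map xs = map (\<lambda>v. v + (letter z - letter p)) (map letter (map r1 xs))"
        using sub xs(1) split_map_right by auto
      moreover have "K.null_list (map letter (map r1 xs))"
      proof (rule os_null_circuit[OF matroid_glued, of "r1 ` C"])
        show "r1 ` C \<in> circuits glued" using C1 by (simp add: circuits_glued)
        show "distinct (map r1 xs)"
          using xs sub inj_relabel(2) by (simp add: distinct_map inj_on_subset)
      qed (simp add: xs(1))
      moreover have "set (map letter (map r1 xs)) \<subseteq> homog (tensor_algebra (ground glued)) 1"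
        using sub xs(1) by (auto simp: ground_glued homog_tensor_iff)
      moreover have "letter z - letter p \<in> homog (tensor_algebra (ground glued)) 1"
        using p_in_images by (intro homog_tensor_diff homog_tensor_letter) (auto simp: ground_glued)
      ultimately show ?thesis by (simp only: K.null_list_translate)
    qed
    then show "\<exists>xs. distinct xs \<and> set xs = C \<and> K.null_list (map split_map xs)"
      using xs by blast
  qed
qed

text \<open>Circuits within one side go back by renaming, with a translation on the
  \<open>G1\<close> side. A circuit through both sides is handled by \<open>null_list_glue\<close>,
  from the two circuits it was glued from.\<close>

lemma join_map_relations:
  assumes "distinct S" "dependent glued (set S)"
  shows "boundary (map join_map S) \<in> os_kernel separate"
proof -
  interpret K: square_zero_ideal "tensor_carrier (ground separate)"
    "homog (tensor_algebra (ground separate)) 1" "os_kernel separate"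
    by (rule square_zero_ideal_os_kernel)
  have null0: "K.null_list (map join_map (map r0 xs))"
    if C: "C \<in> circuits G0" and xs: "set xs = C" "distinct xs" for C xs
  proof -
    have "map join_map (map r0 xs) = map letter xs"
      unfolding map_map using circuit_subset(1)[OF C] xs(1)
      by (intro map_cong refl) (simp only: comp_def, blast intro: join_map_left)
    moreover have "K.null_list (map letter xs)"
      using C xs by (intro os_null_circuit[OF matroid_separate]) (auto simp: circuits_separate)
    ultimately show ?thesis by (simp only:)
  qed
  have null1: "K.null_list (map join_map (map r1 xs))"
    if C: "C \<in> circuits G1" and xs: "set xs = C" "distinct xs" for C xs
  proof -
    have "map join_map (map r1 xs) = map (\<lambda>v. v + (letter p0 - letter p1)) (map letter xs)"
      unfolding map_map using circuit_subset(2)[OF C] xs(1)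
      by (intro map_cong refl) (simp only: comp_def, blast intro: join_map_right)
    moreover have "K.null_list (map letter xs)"
      using C xs by (intro os_null_circuit[OF matroid_separate]) (auto simp: circuits_separate)
    moreover have "set (map letter xs) \<subseteq> homog (tensor_algebra (ground separate)) 1"
      using circuit_subset(2)[OF C] xs(1) by (auto simp: ground_separate homog_tensor_iff)
    moreover have "letter p0 - letter p1 \<in> homog (tensor_algebra (ground separate)) 1"
      using points by (intro homog_tensor_diff homog_tensor_letter) (auto simp: ground_separate)
    ultimately show ?thesis by (simp only: K.null_list_translate)
  qed
  have fin: "finite C" if "C \<in> circuits G0 \<union> circuits G1" for C
    using that matroid_separate unfolding circuits_separate[symmetric]
    by (meson PowD finite_subset matroid_def subsetD)
  show ?thesis
  proof (rule K.boundary_dependent_K[OF join_map_homog _ assms])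
    fix Z assume "Z \<in> circuits glued"
    then consider (left) C where "C \<in> circuits G0" "Z = r0 ` C"
      | (right) C where "C \<in> circuits G1" "Z = r1 ` C"
      | (both) C D where "C \<in> circuits G0" "D \<in> circuits G1" "p \<in> r0 ` C" "p \<in> r1 ` D"
          "Z = (r0 ` C - {p}) \<union> (r1 ` D - {p})"
      unfolding circuits_glued by blast
    then show "\<exists>zs. distinct zs \<and> set zs = Z \<and> K.null_list (map join_map zs)"
    proof cases
      case (left C)
      obtain xs where xs: "set xs = C" "distinct xs"
        using finite_distinct_list fin left(1) by blast
      have "distinct (map r0 xs)"
        using xs inj_on_subset[OF inj_relabel(1) circuit_subset(1)[OF left(1)]]
        by (simp add: distinct_map)
      moreover have "set (map r0 xs) = Z"
        unfolding left(2) set_map xs(1) ..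
      ultimately show ?thesis using null0[OF left(1) xs] by blast
    next
      case (right C)
      obtain xs where xs: "set xs = C" "distinct xs"
        using finite_distinct_list fin right(1) by blast
      have "distinct (map r1 xs)"
        using xs inj_on_subset[OF inj_relabel(2) circuit_subset(2)[OF right(1)]]
        by (simp add: distinct_map)
      moreover have "set (map r1 xs) = Z"
        unfolding right(2) set_map xs(1) ..
      ultimately show ?thesis using null1[OF right(1) xs] by blast
    next
      case (both C D)
      note sub = circuit_subset(1)[OF both(1)] circuit_subset(2)[OF both(2)]
      have p: "p \<notin> C - {p0}" "p \<notin> D - {p1}"
        using sub p_fresh by blast+
      note C = relabel_point[OF both(3) p(1)] and D = relabel_point[OF both(4) p(2)]
      obtain us where us: "set us = C - {p0}" "distinct us"
        using finite_distinct_list fin both(1) by (metis UnI1 finite_Diff)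
      obtain vs where vs: "set vs = D - {p1}" "distinct vs"
        using finite_distinct_list fin both(2) by (metis UnI2 finite_Diff)
      \<comment> \<open>Listing \<open>C\<close> and \<open>D\<close> with their base points first
        makes both relabelled lists start with \<open>p\<close> and leaves the tails fixed, so
        \<open>join_map p\<close> is the common vector \<open>q\<close> of
        \<open>null_list_glue\<close>.\<close>
      have "map r0 (p0 # us) = p # us" "map r1 (p1 # vs) = p # vs"
        using us(1) vs(1) by (simp_all add: map_idI)
      moreover have "set (p0 # us) = C" "distinct (p0 # us)" "set (p1 # vs) = D" "distinct (p1 # vs)"
        using us vs C(1) D(1) by auto
      ultimately have null: "K.null_list (join_map p # map join_map us)"
        "K.null_list (join_map p # map join_map vs)"
        using null0[OF both(1), of "p0 # us"] null1[OF both(2), of "p1 # vs"]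
        by (simp_all only: list.map)
      have "C - {p0} \<subseteq> r0 ` ground G0" "D - {p1} \<subseteq> r1 ` ground G1"
        unfolding C(2)[symmetric] D(2)[symmetric]
        by (intro order_trans[OF Diff_subset] image_mono sub)+
      then have gr: "p \<in> ground glued" "set us \<subseteq> ground glued" "set vs \<subseteq> ground glued"
        using p_in_images(1) unfolding ground_glued us(1) vs(1)
        by (simp_all add: subset_insertI2 le_supI1 le_supI2)
      have V: "join_map p \<in> homog (tensor_algebra (ground separate)) 1"
        "set (map join_map us) \<subseteq> homog (tensor_algebra (ground separate)) 1"
        "set (map join_map vs) \<subseteq> homog (tensor_algebra (ground separate)) 1"
        unfolding set_map using gr join_map_homog by blast+
      have "K.null_list (map join_map us @ map join_map vs)"
        by (rule K.null_list_glue[OF null V])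
      \<comment> \<open>Without their base points the two circuits are disjoint, so the
        concatenation enumerates the glued circuit without repetition.\<close>
      moreover have "set us \<inter> set vs = {}"
        unfolding us(1) vs(1) using sub disjoint by blast
      then have "distinct (us @ vs)" using us(2) vs(2) by simp
      moreover have "set (us @ vs) = Z"
        unfolding both(5) C(2) D(2) set_append us(1) vs(1) ..
      ultimately show ?thesis unfolding map_append[symmetric] by blast
    qed
  qed
qed

lemma orlik_solomon_separate_glued: "orlik_solomon separate \<cong>\<^sub>g\<^sub>r orlik_solomon glued"
  using split_map_homog join_map_homog split_map_relations join_map_relations join_split split_join
  by (rule orlik_solomon_isomorphicI)

end

theorem theorem3p8:
  fixes G0 G1 :: "'a circuit_system" and p0 p1 p z :: 'a
  assumes "simple_matroid G0" and "simple_matroid G1"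
    and "ground G0 \<noteq> {}" and "ground G1 \<noteq> {}"
    and "ground G0 \<inter> ground G1 = {}"
    and "p0 \<in> ground G0" and "p1 \<in> ground G1"
    and "p \<notin> (ground G0 - {p0}) \<union> (ground G1 - {p1})"
    and "z \<notin> ground (parallel_connection G0 p0 G1 p1 p)"
  shows "orlik_solomon (direct_sum G0 G1) \<cong>\<^sub>g\<^sub>r
         orlik_solomon (direct_sum (isthmus z) (parallel_connection G0 p0 G1 p1 p))"
proof -
  interpret parallel_gluing G0 G1 p0 p1 p z
    using assms by unfold_locales
  show ?thesis using orlik_solomon_separate_glued unfolding separate_def glued_def .
qed

end
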